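(* Let $ABC$ be a triangle in the hyperbolic plane. Let $M_a, M_b, M_c$ be the points on the sides $BC$, $CA$, $AB$ respectively such that each of the segments $AM_a$, $BM_b$, $CM_c$ divides triangle $ABC$ into two triangles of equal hyperbolic area. Assume that $A,B,C$ lie on a hyperbolic circle with center $O$ and that $M_a, M_b, M_c$ lie on a hyperbolic circle $\Omega$ with center $E$. Let $H_a, H_b, H_c$ be the second points of intersection of $\Omega$ with the lines $BC$, $CA$, $AB$ respectively (besides $M_a, M_b, M_c$), and assume that the lines $AH_a, BH_b, CH_c$ pairwise intersect. Then the lines $AM_a, BM_b, CM_c$ meet at a single point $M$, the lines $AH_a, BH_b, CH_c$ meet at a single point $H$, and the four points $O$, $M$, $E$, $H$ lie on one straight line.
   Context: Intersections are counted with multiplicity: if $\Omega$ is tangent to the line $BC$ at $M_a$, then $H_a=M_a$, and similarly for $H_b$, $H_c$. *)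

theory Defs
  imports "HOL-Analysis.Analysis"
begin

text \<open>
  The hyperbolic plane of curvature \<open>-1\<close> in the Beltrami--Klein model: points are the points of
  the open unit disc of \<open>real ^ 2\<close> and lines are its open chords, so hyperbolic segments and
  triangles coincide with the Euclidean ones having the same vertices.
\<close>

definition hplane :: "(real ^ 2) set" where
  "hplane = ball 0 1"

definition hdist :: "real ^ 2 \<Rightarrow> real ^ 2 \<Rightarrow> real" where
  "hdist P Q = arcosh ((1 - P \<bullet> Q) / (sqrt (1 - (norm P)\<^sup>2) * sqrt (1 - (norm Q)\<^sup>2)))"

text \<open>Meaningful for \<open>P \<noteq> Q\<close> only.\<close>

definition hline :: "real ^ 2 \<Rightarrow> real ^ 2 \<Rightarrow> (real ^ 2) set" where
  "hline P Q = affine hull {P, Q} \<inter> hplane"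

definition is_hline :: "(real ^ 2) set \<Rightarrow> bool" where
  "is_hline l \<longleftrightarrow> (\<exists>P \<in> hplane. \<exists>Q \<in> hplane. P \<noteq> Q \<and> l = hline P Q)"

definition hcollinear :: "(real ^ 2) set \<Rightarrow> bool" where
  "hcollinear S \<longleftrightarrow> (\<exists>l. is_hline l \<and> S \<subseteq> l)"

abbreviation hsegment :: "real ^ 2 \<Rightarrow> real ^ 2 \<Rightarrow> (real ^ 2) set" where
  "hsegment P Q \<equiv> closed_segment P Q"

abbreviation htriangle :: "real ^ 2 \<Rightarrow> real ^ 2 \<Rightarrow> real ^ 2 \<Rightarrow> (real ^ 2) set" where
  "htriangle P Q R \<equiv> convex hull {P, Q, R}"

definition hcircle :: "real ^ 2 \<Rightarrow> real \<Rightarrow> (real ^ 2) set" where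
  "hcircle Z r = {X \<in> hplane. hdist Z X = r}"

text \<open>
  The Riemannian area. The Klein metric at \<open>x\<close> is
  \<open>|dx|\<^sup>2 / (1 - |x|\<^sup>2) + (x \<bullet> dx)\<^sup>2 / (1 - |x|\<^sup>2)\<^sup>2\<close>, with Gram determinant \<open>(1 - |x|\<^sup>2) ^ (-3)\<close>.
\<close>

definition harea_measure :: "(real ^ 2) measure" where
  "harea_measure = density lborel
     (\<lambda>x. ennreal (indicator hplane x / sqrt (1 - (norm x)\<^sup>2) ^ 3))"

definition harea :: "(real ^ 2) set \<Rightarrow> ennreal" where
  "harea S = emeasure harea_measure S"

text \<open>
  A line meets a hyperbolic circle in at most two points, and it is tangent to the circle exactly
  when it meets it once.
\<close>

definition htangent_at :: "(real ^ 2) set \<Rightarrow> (real ^ 2) set \<Rightarrow> real ^ 2 \<Rightarrow> bool" where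
  "htangent_at l \<Omega> P \<longleftrightarrow> l \<inter> \<Omega> = {P}"

definition second_intersection ::
    "(real ^ 2) set \<Rightarrow> (real ^ 2) set \<Rightarrow> real ^ 2 \<Rightarrow> real ^ 2 \<Rightarrow> bool" where
  "second_intersection l \<Omega> P Q \<longleftrightarrow>
     (if htangent_at l \<Omega> P then Q = P else Q \<in> l \<inter> \<Omega> \<and> Q \<noteq> P)"

end

theory Submission
  imports Defs
begin

text \<open>
  Lift the Klein model to the hyperboloid of Minkowski space, where lines become planes through the
  origin and the circle with centre \<open>E\<close> becomes the section by \<open>\<langle>e, x\<rangle> = 1\<close> with \<open>e\<close> a multiple of
  the lift of \<open>E\<close>. Let \<open>a, b, c\<close> be the lifted vertices and write
  \<open>\<langle>b, c\<rangle> = 2 p\<^sup>2 - 1\<close>, \<open>\<langle>c, a\<rangle> = 2 q\<^sup>2 - 1\<close>, \<open>\<langle>a, b\<rangle> = 2 r\<^sup>2 - 1\<close>, so that \<open>p, q, r\<close> are the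
  hyperbolic cosines of the half sides. The half-area formula shows that \<open>M\<^sub>a\<close> is proportional to
  \<open>q / (q + p r) b + r / (r + p q) c\<close>, hence \<open>M = p / (p + q r) a + q / (q + p r) b + r / (r + p q) c\<close>
  lies on all three bisectors. Since \<open>\<langle>e, \<cdot>\<rangle> = 1\<close> at \<open>M\<^sub>a, M\<^sub>b, M\<^sub>c\<close>, one finds \<open>\<langle>e, a\<rangle> = q r / p\<close>
  and its analogues. Vieta's formula on the line \<open>BC\<close> then gives \<open>H\<^sub>a\<close>, and \<open>H\<close> arises from \<open>M\<close> by
  changing the signs of \<open>p, q, r\<close>. Finally, if \<open>o\<close> is the multiple of the lift of the circumcentre
  with \<open>\<langle>o, a\<rangle> = \<langle>o, b\<rangle> = \<langle>o, c\<rangle> = 1\<close>, comparing products with \<open>a, b, c\<close> shows that \<open>M\<close> and \<open>H\<close> are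
  proportional to \<open>o + 2 e\<close> and \<open>o - 2 e\<close>.
\<close>

section \<open>Lebesgue measure under affine maps\<close>

text \<open>\<open>lborel\<close> is determined by its values on boxes. The preimage of a box is its
  image under the inverse map, and the measure of that image times
  \<open>\<bar>det (matrix f)\<bar>\<close> is the measure of the box.\<close>

lemma lborel_eq_linear_distr:
  fixes f :: "real ^ 'n::{finite,wellorder} \<Rightarrow> real ^ 'n::_"
  assumes f: "linear f" and det: "det (matrix f) \<noteq> 0"
  shows "lborel = density (distr lborel borel f) (\<lambda>_. ennreal \<bar>det (matrix f)\<bar>)"
proof (rule lborel_eqI)
  have meas [measurable]: "f \<in> borel_measurable borel"
    using f by (intro borel_measurable_continuous_onI linear_continuous_on)
      (simp add: linear_conv_bounded_linear)
  have "inj f" using det_nz_iff_inj[OF f] det by simp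
  then obtain g where g: "linear g" "g \<circ> f = id" "f \<circ> g = id"
    using linear_injective_isomorphism[OF f] by (metis comp_def id_apply ext)
  fix l u :: "real ^ 'n::_"
  assume "\<And>b. b \<in> Basis \<Longrightarrow> l \<bullet> b \<le> u \<bullet> b"
  then have box: "emeasure lborel (box l u) = ennreal (\<Prod>b\<in>Basis. (u - l) \<bullet> b)"
    by (rule emeasure_lborel_box)
  have pre: "f -` box l u = g ` box l u"
    using g(2,3) by (auto simp: fun_eq_iff image_iff) (metis)
  have lm: "g ` box l u \<in> lmeasurable"
    using measurable_linear_image[OF g(1)] by simp
  have img: "f ` (g ` box l u) = box l u"
    using g(3) by (simp add: image_image fun_eq_iff)
  have "measure lebesgue (box l u) = \<bar>det (matrix f)\<bar> * measure lebesgue (g ` box l u)"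
    using measure_linear_image[OF f lm] by (simp only: img)
  moreover have "emeasure lebesgue (g ` box l u) = ennreal (measure lebesgue (g ` box l u))"
    using lm by (rule emeasure_eq_measure2)
  moreover have "emeasure lebesgue (box l u) = ennreal (measure lebesgue (box l u))"
    by (rule emeasure_eq_measure2) simp
  moreover have "f -` box l u \<in> sets borel"
    using measurable_sets[OF meas, of "box l u"] by simp
  ultimately show "emeasure (density (distr lborel borel f) (\<lambda>_. ennreal \<bar>det (matrix f)\<bar>)) (box l u)
      = ennreal (\<Prod>b\<in>Basis. (u - l) \<bullet> b)"
    by (simp add: emeasure_density_const emeasure_distr box[symmetric] ennreal_mult pre)
qed simp

text \<open>Splits \<open>real ^ 2\<close> into its two coordinates, so that Tonelli's theorem for
  product measures becomes applicable.\<close>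

lemma lborel_eq_distr_real2:
  "lborel = distr (lborel \<Otimes>\<^sub>M lborel) borel (\<lambda>z. fst z *\<^sub>R axis 1 1 + snd z *\<^sub>R axis 2 1 :: real ^ 2)"
proof (rule lborel_eqI)
  let ?f = "\<lambda>z. fst z *\<^sub>R axis 1 1 + snd z *\<^sub>R axis 2 1 :: real ^ 2"
  have m [measurable]: "?f \<in> borel_measurable (lborel \<Otimes>\<^sub>M lborel)"
    unfolding lborel_prod by (simp add: borel_measurable_continuous_onI continuous_intros)
  fix l u :: "real ^ 2"
  assume le: "\<And>b. b \<in> Basis \<Longrightarrow> l \<bullet> b \<le> u \<bullet> b"
  have le': "l $ 1 \<le> u $ 1" "l $ 2 \<le> u $ 2"
    using le[of "axis 1 1"] le[of "axis 2 1"] by (auto simp: inner_axis axis_in_Basis_iff)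
  have pre: "?f -` box l u = {l$1<..<u$1} \<times> {l$2<..<u$2}"
    by (auto simp: mem_box_cart forall_2 axis_def)
  have "emeasure (lborel \<Otimes>\<^sub>M lborel) ({l$1<..<u$1} \<times> {l$2<..<u$2}) = ennreal ((u$1 - l$1) * (u$2 - l$2))"
    using le' by (subst lborel.emeasure_pair_measure_Times) (auto simp: ennreal_mult)
  also have "(u$1 - l$1) * (u$2 - l$2) = (\<Prod>b\<in>Basis. (u - l) \<bullet> b)"
    by (simp add: Basis_vec_def UNIV_2 inner_axis axis_eq_axis)
  finally show "emeasure (distr (lborel \<Otimes>\<^sub>M lborel) borel ?f) (box l u)
      = ennreal (\<Prod>b\<in>Basis. (u - l) \<bullet> b)"
    by (subst emeasure_distr) (simp_all add: pre space_pair_measure)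
qed simp

text \<open>Combines a translation, the linear map with columns \<open>p\<close> and
  \<open>q\<close>, and the splitting into coordinates; the Jacobian is the determinant.\<close>

lemma nn_integral_lborel_affine_real2:
  fixes A p q :: "real ^ 2"
  assumes D: "p $ 1 * q $ 2 - p $ 2 * q $ 1 \<noteq> 0" and [measurable]: "g \<in> borel_measurable borel"
  shows "(\<integral>\<^sup>+x. g x \<partial>lborel) = ennreal \<bar>p $ 1 * q $ 2 - p $ 2 * q $ 1\<bar> *
    (\<integral>\<^sup>+u. \<integral>\<^sup>+v. g (A + u *\<^sub>R p + v *\<^sub>R q) \<partial>lborel \<partial>lborel)"
proof -
  define f where "f = (\<lambda>x::real^2. x $ 1 *\<^sub>R p + x $ 2 *\<^sub>R q)"
  have f: "linear f"
    by (intro linearI) (simp_all add: f_def algebra_simps)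
  have meas [measurable]: "f \<in> borel_measurable borel"
    using f by (intro borel_measurable_continuous_onI linear_continuous_on)
      (simp add: linear_conv_bounded_linear)
  have det: "det (matrix f) = p $ 1 * q $ 2 - p $ 2 * q $ 1"
    by (simp add: det_2 matrix_def f_def axis_def)
  have e [measurable]: "(\<lambda>z. fst z *\<^sub>R axis 1 1 + snd z *\<^sub>R axis 2 1 :: real ^ 2) \<in> borel_measurable (lborel \<Otimes>\<^sub>M lborel)"
    unfolding lborel_prod by (simp add: borel_measurable_continuous_onI continuous_intros)
  have e' [measurable]: "(\<lambda>z. fst z *\<^sub>R p + snd z *\<^sub>R q) \<in> borel_measurable (lborel \<Otimes>\<^sub>M lborel)"
    unfolding lborel_prod by (simp add: borel_measurable_continuous_onI continuous_intros)
  have "(\<integral>\<^sup>+x. g x \<partial>lborel) = (\<integral>\<^sup>+x. g (A + x) \<partial>lborel)"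
    by (subst lborel_distr_plus[symmetric, of A]) (simp add: nn_integral_distr)
  also have "\<dots> = ennreal \<bar>det (matrix f)\<bar> * (\<integral>\<^sup>+x. g (A + f x) \<partial>lborel)"
    using D by (subst lborel_eq_linear_distr[OF f])
      (simp_all add: det nn_integral_density nn_integral_cmult nn_integral_distr)
  also have "(\<integral>\<^sup>+x. g (A + f x) \<partial>lborel) = (\<integral>\<^sup>+z. g (A + (fst z *\<^sub>R p + snd z *\<^sub>R q)) \<partial>(lborel \<Otimes>\<^sub>M lborel))"
    by (subst lborel_eq_distr_real2) (simp add: nn_integral_distr f_def axis_def)
  also have "\<dots> = (\<integral>\<^sup>+u. \<integral>\<^sup>+v. g (A + (u *\<^sub>R p + v *\<^sub>R q)) \<partial>lborel \<partial>lborel)"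
    by (subst lborel.nn_integral_fst[symmetric]) auto
  finally show ?thesis
    by (simp add: det add.assoc)
qed

section \<open>The area of a hyperbolic triangle\<close>

text \<open>An antiderivative is \<open>(\<alpha> + \<beta> u) / sqrt (f u)\<close> divided by the
  discriminant, because \<open>\<beta> f(u) - (\<alpha> + \<beta> u) (\<beta> + \<gamma> u) = u
  (\<beta>\<^sup>2 - \<alpha> \<gamma>)\<close>. Along a ray from a vertex the squared Klein factor
  is such a quadratic, and the numerator \<open>u\<close> is the Jacobian of polar
  coordinates.\<close>

lemma nn_integral_radial:
  fixes \<alpha> \<beta> \<gamma> :: real
  assumes pos: "\<And>u. 0 \<le> u \<Longrightarrow> u \<le> 1 \<Longrightarrow> \<alpha> + 2 * \<beta> * u + \<gamma> * u\<^sup>2 > 0" and disc: "\<beta>\<^sup>2 - \<alpha> * \<gamma> > 0"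
  shows "(\<integral>\<^sup>+u. ennreal (u / sqrt (\<alpha> + 2 * \<beta> * u + \<gamma> * u\<^sup>2) ^ 3) * indicator {0..1} u \<partial>lborel)
    = ennreal (((\<alpha> + \<beta>) / sqrt (\<alpha> + 2 * \<beta> + \<gamma>) - sqrt \<alpha>) / (\<beta>\<^sup>2 - \<alpha> * \<gamma>))"
proof -
  define f where "f = (\<lambda>u. \<alpha> + 2 * \<beta> * u + \<gamma> * u\<^sup>2)"
  define F where "F = (\<lambda>u. (\<alpha> + \<beta> * u) / sqrt (f u) / (\<beta>\<^sup>2 - \<alpha> * \<gamma>))"
  have "(\<integral>\<^sup>+u. ennreal (u / sqrt (f u) ^ 3) * indicator {0..1} u \<partial>lborel) = ennreal (F 1 - F 0)"
  proof (rule nn_integral_FTC_Icc)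
    fix u :: real assume u: "u \<in> {0..1}"
    then have fu: "f u > 0" using pos by (simp add: f_def)
    define R where "R = sqrt (f u)"
    have R: "R > 0" "f u = R\<^sup>2" using fu by (auto simp: R_def)
    have R': "R\<^sup>2 = \<alpha> + 2 * \<beta> * u + \<gamma> * u\<^sup>2"
      using R(2) by (simp add: f_def)
    have df: "(f has_real_derivative (2 * \<beta> + 2 * \<gamma> * u)) (at u)"
      unfolding f_def by (auto intro!: derivative_eq_intros)
    have ds: "((\<lambda>u. sqrt (f u)) has_real_derivative ((\<beta> + \<gamma> * u) / R)) (at u)"
      by (rule DERIV_cong[OF DERIV_chain2[OF DERIV_real_sqrt[OF fu] df]])
        (use R(1) in \<open>simp add: R_def field_simps\<close>)
    have "(F has_real_derivative ((\<beta> * R - (\<alpha> + \<beta> * u) * ((\<beta> + \<gamma> * u) / R)) / (R * R)) / (\<beta>\<^sup>2 - \<alpha> * \<gamma>)) (at u)"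
      unfolding F_def
    proof (intro DERIV_cdivide)
      have "((\<lambda>u. \<alpha> + \<beta> * u) has_real_derivative \<beta>) (at u)"
        by (auto intro!: derivative_eq_intros)
      from DERIV_divide[OF this ds] R(1)
      show "((\<lambda>u. (\<alpha> + \<beta> * u) / sqrt (f u)) has_real_derivative
          (\<beta> * R - (\<alpha> + \<beta> * u) * ((\<beta> + \<gamma> * u) / R)) / (R * R)) (at u)"
        by (simp add: R_def)
    qed
    also have "(\<beta> * R - (\<alpha> + \<beta> * u) * ((\<beta> + \<gamma> * u) / R)) / (R * R)
        = (\<beta> * R\<^sup>2 - (\<alpha> + \<beta> * u) * (\<beta> + \<gamma> * u)) / R ^ 3"
      using R(1) by (simp add: field_simps power3_eq_cube power2_eq_square)
    also have "\<beta> * R\<^sup>2 - (\<alpha> + \<beta> * u) * (\<beta> + \<gamma> * u) = u * (\<beta>\<^sup>2 - \<alpha> * \<gamma>)"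
      unfolding R' by (simp add: algebra_simps power2_eq_square)
    finally show "(F has_real_derivative u / sqrt (f u) ^ 3) (at u)"
      using disc by (simp add: R_def)
    show "0 \<le> u / sqrt (f u) ^ 3" using u fu by simp
  next
    show "(\<lambda>u. u / sqrt (f u) ^ 3) \<in> borel_measurable borel"
      unfolding f_def by measurable
  qed simp
  moreover have "F 1 - F 0 = ((\<alpha> + \<beta>) / sqrt (\<alpha> + 2 * \<beta> + \<gamma>) - sqrt \<alpha>) / (\<beta>\<^sup>2 - \<alpha> * \<gamma>)"
    using pos[of 0] real_div_sqrt[of \<alpha>]
    by (simp add: F_def f_def diff_divide_distrib flip: divide_divide_eq_left)
  ultimately show ?thesis
    by (simp add: f_def)
qed

text \<open>Here \<open>x t\<close>, \<open>kB\<^sup>2 + t * bd\<close> and \<open>ab + t * ad\<close> stand for the Klein factor of the point \<open>X t\<close>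
  of the line \<open>BC\<close> and for its Lorentz products with the lifts \<open>(1, B)\<close> and \<open>(1, A)\<close>; the last
  assumption expresses the Gram determinant of the lifts of \<open>A\<close>, \<open>B\<close> and \<open>X t\<close>.\<close>

lemma nn_integral_angular:
  fixes kA kB ab ad bd dd D \<tau> :: real
  defines "x \<equiv> \<lambda>t. sqrt (kB\<^sup>2 + 2 * t * bd + t\<^sup>2 * dd)"
  defines "N \<equiv> \<lambda>t. x t * (kA * kB + ab) + (kB\<^sup>2 + t * bd) * kA + (ab + t * ad) * kB"
  assumes \<tau>: "0 \<le> \<tau>" and kA: "kA > 0" and kB: "kB > 0" and D: "D > 0" and ab: "ab > 0"
    and pos: "\<And>t. 0 \<le> t \<Longrightarrow> t \<le> \<tau> \<Longrightarrow> kB\<^sup>2 + 2 * t * bd + t\<^sup>2 * dd > 0"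
      "\<And>t. 0 \<le> t \<Longrightarrow> t \<le> \<tau> \<Longrightarrow> kB\<^sup>2 + t * bd > 0"
      "\<And>t. 0 \<le> t \<Longrightarrow> t \<le> \<tau> \<Longrightarrow> ab + t * ad > 0"
    and gram: "\<And>t. (D * t)\<^sup>2 = kA\<^sup>2 * kB\<^sup>2 * (kB\<^sup>2 + 2 * t * bd + t\<^sup>2 * dd)
      + 2 * ab * (kB\<^sup>2 + t * bd) * (ab + t * ad) - kA\<^sup>2 * (kB\<^sup>2 + t * bd)\<^sup>2 - kB\<^sup>2 * (ab + t * ad)\<^sup>2
      - (kB\<^sup>2 + 2 * t * bd + t\<^sup>2 * dd) * ab\<^sup>2"
  shows "(\<integral>\<^sup>+t. ennreal (D / (x t * (ab + t * ad + kA * x t))) * indicator {0..\<tau>} t \<partial>lborel)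
    = ennreal (2 * arctan (D * \<tau> / N \<tau>))"
proof -
  have "(\<integral>\<^sup>+t. ennreal (D / (x t * (ab + t * ad + kA * x t))) * indicator {0..\<tau>} t \<partial>lborel)
    = ennreal (2 * arctan (D * \<tau> / N \<tau>) - 2 * arctan (D * 0 / N 0))"
  proof (rule nn_integral_FTC_Icc)
    fix t assume t: "t \<in> {0..\<tau>}"
    define R where "R = x t"
    define bx where "bx = kB\<^sup>2 + t * bd"
    define ax where "ax = ab + t * ad"
    have R: "R > 0" "R\<^sup>2 = kB\<^sup>2 + 2 * t * bd + t\<^sup>2 * dd"
      using pos(1)[of t] t by (auto simp: R_def x_def)
    have bx: "bx > 0" and ax: "ax > 0" using pos(2,3)[of t] t by (auto simp: bx_def ax_def)
    have N: "N t = R * (kA * kB + ab) + bx * kA + ax * kB" by (simp add: N_def R_def bx_def ax_def)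
    have Npos: "N t > 0" unfolding N using R bx ax kA kB ab by (simp add: add_pos_pos)
    have dx: "(x has_real_derivative ((bd + t * dd) / R)) (at t)"
    proof -
      have df: "((\<lambda>t. kB\<^sup>2 + 2 * t * bd + t\<^sup>2 * dd) has_real_derivative (2 * bd + 2 * t * dd)) (at t)"
        by (auto intro!: derivative_eq_intros)
      show ?thesis
        unfolding x_def
      proof (rule DERIV_cong[OF DERIV_chain2[OF DERIV_real_sqrt df]])
        show "0 < kB\<^sup>2 + 2 * t * bd + t\<^sup>2 * dd" using pos(1)[of t] t by simp
        show "inverse (sqrt (kB\<^sup>2 + 2 * t * bd + t\<^sup>2 * dd)) / 2 * (2 * bd + 2 * t * dd) = (bd + t * dd) / R"
          unfolding R(2)[symmetric] using R(1) by (simp add: field_simps)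
      qed
    qed
    define N' where "N' = (bd + t * dd) / R * (kA * kB + ab) + bd * kA + ad * kB"
    have dN: "(N has_real_derivative N') (at t)"
      unfolding N_def N'_def by (auto intro!: derivative_eq_intros dx)
    have "((\<lambda>t. 2 * arctan (D * t / N t)) has_real_derivative
        2 * ((D * N t - D * t * N') / (N t * N t) * inverse (1 + (D * t / N t)\<^sup>2))) (at t)"
      using Npos by (auto intro!: derivative_eq_intros dN)
    also have "2 * ((D * N t - D * t * N') / (N t * N t) * inverse (1 + (D * t / N t)\<^sup>2))
        = 2 * D * (N t - t * N') / ((N t)\<^sup>2 + (D * t)\<^sup>2)"
    proof -
      have "(N t)\<^sup>2 + (D * t)\<^sup>2 > 0" using Npos by (simp add: add_pos_nonneg)
      moreover have "1 + (D * t / N t)\<^sup>2 = ((N t)\<^sup>2 + (D * t)\<^sup>2) / (N t * N t)"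
        using Npos by (simp add: field_simps power2_eq_square)
      ultimately show ?thesis using Npos
        by (simp add: divide_simps) (simp add: algebra_simps)
    qed
    also have "\<dots> = D / (R * (ax + kA * R))"
    proof -
      have g: "(D * t)\<^sup>2 = kA\<^sup>2 * kB\<^sup>2 * R\<^sup>2 + 2 * ab * bx * ax - kA\<^sup>2 * bx\<^sup>2 - kB\<^sup>2 * ax\<^sup>2 - R\<^sup>2 * ab\<^sup>2"
        using gram[of t] R(2) by (simp add: bx_def ax_def)
      \<comment> \<open>If \<open>det\<^sup>2 = 1 + 2 f g h - f\<^sup>2 - g\<^sup>2 -
        h\<^sup>2\<close>, then \<open>(1 + f + g + h)\<^sup>2 + det\<^sup>2 = 2 (1 + f) (1 + g) (1
        + h)\<close>. This is that identity cleared of Klein factors.\<close>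
      have 1: "(N t)\<^sup>2 + (D * t)\<^sup>2 = 2 * (kA * kB + ab) * (kB * R + bx) * (R * kA + ax)"
        unfolding g N by (simp add: algebra_simps power2_eq_square)
      have "R * (R - t * ((bd + t * dd) / R)) = bx"
        using R by (simp add: field_simps bx_def power2_eq_square)
      moreover have "N t - t * N' = (R - t * ((bd + t * dd) / R)) * (kA * kB + ab) + kB * (kB * kA + ab)"
        unfolding N N'_def bx_def ax_def by (simp add: algebra_simps power2_eq_square)
      \<comment> \<open>Two of the three factors of the denominator recur here, so that besides
        \<open>R\<close> only \<open>R * kA + ax\<close> survives in the quotient.\<close>
      ultimately have 2: "R * (N t - t * N') = (kA * kB + ab) * (bx + kB * R)"
        by (simp only: ring_distribs mult.assoc[symmetric]) (simp add: algebra_simps)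
      have "2 * (N t - t * N') * (R * (ax + kA * R)) = (N t)\<^sup>2 + (D * t)\<^sup>2"
        unfolding 1 using arg_cong[OF 2, of "\<lambda>z. 2 * (ax + kA * R) * z"] by (simp add: algebra_simps)
      moreover have "R * (ax + kA * R) > 0" "(N t)\<^sup>2 + (D * t)\<^sup>2 > 0"
        using R ax kA Npos by (auto simp: add_pos_pos add_pos_nonneg)
      moreover have "2 * D * w / n = D / d" if "2 * w * d = n" "n > 0" "d > 0" for w n d :: real
        using that by (auto simp: zero_less_mult_iff)
      ultimately show ?thesis by blast
    qed
    finally show "((\<lambda>t. 2 * arctan (D * t / N t)) has_real_derivative D / (x t * (ab + t * ad + kA * x t))) (at t)"
      by (simp add: R_def ax_def)
    show "0 \<le> D / (x t * (ab + t * ad + kA * x t))"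
      using R(1) ax kA D by (simp add: R_def ax_def)
  next
    show "(\<lambda>t. D / (x t * (ab + t * ad + kA * x t))) \<in> borel_measurable borel"
      unfolding x_def by measurable
  qed (use \<tau> in auto)
  then show ?thesis by simp
qed


section \<open>Klein factors and polar coordinates about a vertex\<close>

definition klein_factor :: "real ^ 2 \<Rightarrow> real" where
  "klein_factor X = sqrt (1 - X \<bullet> X)"

lemma hplane_iff: "X \<in> hplane \<longleftrightarrow> X \<bullet> X < 1"
  by (simp add: hplane_def norm_eq_sqrt_inner)

lemma klein_factor_pos: "X \<in> hplane \<Longrightarrow> klein_factor X > 0"
  by (simp add: klein_factor_def hplane_iff)

lemma klein_factor_square: "X \<in> hplane \<Longrightarrow> (klein_factor X)\<^sup>2 = 1 - X \<bullet> X"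
  by (simp add: klein_factor_def hplane_iff)

lemma inner_less_1: "X \<in> hplane \<Longrightarrow> Y \<in> hplane \<Longrightarrow> X \<bullet> Y < 1"
proof -
  assume "X \<in> hplane" "Y \<in> hplane"
  moreover have "2 * (X \<bullet> Y) \<le> X \<bullet> X + Y \<bullet> Y"
    using inner_ge_zero[of "X - Y"] by (simp add: inner_diff inner_commute)
  ultimately show ?thesis by (simp add: hplane_iff)
qed

lemma convex_hplane: "convex hplane"
  by (simp add: hplane_def)

lemma harea_eq_nn_integral:
  assumes "S \<in> sets borel" "S \<subseteq> hplane"
  shows "harea S = (\<integral>\<^sup>+x. ennreal (1 / klein_factor x ^ 3) * indicator S x \<partial>lborel)"
proof -
  have [measurable]: "hplane \<in> sets borel" by (simp add: hplane_def)
  have "harea S = (\<integral>\<^sup>+x. ennreal (indicator hplane x / sqrt (1 - (norm x)\<^sup>2) ^ 3) * indicator S x \<partial>lborel)"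
    using assms unfolding harea_def harea_measure_def
    by (subst emeasure_density) auto
  also have "\<dots> = (\<integral>\<^sup>+x. ennreal (1 / klein_factor x ^ 3) * indicator S x \<partial>lborel)"
    using assms(2)
    by (intro nn_integral_cong) (auto simp: indicator_def klein_factor_def power2_norm_eq_inner)
  finally show ?thesis .
qed

abbreviation cross2 :: "real ^ 2 \<Rightarrow> real ^ 2 \<Rightarrow> real" where
  "cross2 p q \<equiv> p $ 1 * q $ 2 - p $ 2 * q $ 1"

lemma inner_real2: "x \<bullet> y = x $ 1 * y $ 1 + x $ 2 * y $ (2::2)" for x y :: "real ^ 2"
  by (simp add: inner_vec_def sum_2)

lemma cross2_independent:
  assumes "cross2 p q \<noteq> 0" "u *\<^sub>R p + v *\<^sub>R q = 0"
  shows "u = 0" "v = 0"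
proof -
  have e: "u * p $ 1 + v * q $ 1 = 0" "u * p $ 2 + v * q $ 2 = 0"
    using arg_cong[OF assms(2), of "\<lambda>x. x $ 1"] arg_cong[OF assms(2), of "\<lambda>x. x $ 2"] by auto
  have "u * cross2 p q = (u * p $ 1 + v * q $ 1) * q $ 2 - (u * p $ 2 + v * q $ 2) * q $ 1"
    by (simp add: algebra_simps)
  then show "u = 0" using assms(1) by (simp add: e)
  have "v * cross2 p q = (u * p $ 2 + v * q $ 2) * p $ 1 - (u * p $ 1 + v * q $ 1) * p $ 2"
    by (simp add: algebra_simps)
  then show "v = 0" using assms(1) by (simp add: e)
qed

text \<open>In the oblique coordinates \<open>u\<close>, \<open>v\<close> the vertex
  \<open>A\<close> is the origin, the side \<open>BC\<close> lies on \<open>u = 1\<close>, and the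
  rays from \<open>A\<close> into the triangle are \<open>v = u * t\<close> with \<open>t\<close>
  between 0 and \<tau>.\<close>

lemma mem_htriangle_cevian_iff:
  assumes D: "cross2 (B - A) (C - B) \<noteq> 0" and \<tau>: "0 \<le> \<tau>"
  shows "A + u *\<^sub>R (B - A) + v *\<^sub>R (C - B) \<in> htriangle A B (B + \<tau> *\<^sub>R (C - B))
    \<longleftrightarrow> 0 \<le> u \<and> u \<le> 1 \<and> 0 \<le> v \<and> v \<le> u * \<tau>"
proof
  assume "A + u *\<^sub>R (B - A) + v *\<^sub>R (C - B) \<in> htriangle A B (B + \<tau> *\<^sub>R (C - B))"
  then obtain x y where xy: "x \<ge> 0" "y \<ge> 0" "x + y \<le> 1" and
    "A + u *\<^sub>R (B - A) + v *\<^sub>R (C - B) = A + x *\<^sub>R (B - A) + y *\<^sub>R (B + \<tau> *\<^sub>R (C - B) - A)"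
    unfolding convex_hull_3_alt by blast
  then have "(u - x - y) *\<^sub>R (B - A) + (v - y * \<tau>) *\<^sub>R (C - B) = 0"
    by (simp add: algebra_simps)
  then have "u = x + y" "v = y * \<tau>"
    using cross2_independent[OF D] by fastforce+
  then show "0 \<le> u \<and> u \<le> 1 \<and> 0 \<le> v \<and> v \<le> u * \<tau>"
    using xy \<tau> by (simp add: mult_right_mono)
next
  assume uv: "0 \<le> u \<and> u \<le> 1 \<and> 0 \<le> v \<and> v \<le> u * \<tau>"
  \<comment> \<open>The weight of the third vertex. For \<open>\<tau> = 0\<close> the triangle
    degenerates to the segment \<open>AB\<close>, where \<open>v = 0\<close> and this weight can be
    taken as 0.\<close>
  define y where "y = (if \<tau> = 0 then 0 else v / \<tau>)"
  have y: "0 \<le> y" "y \<le> u" "y * \<tau> = v"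
    using uv \<tau> by (auto simp: y_def field_simps)
  have "A + u *\<^sub>R (B - A) + v *\<^sub>R (C - B) = A + (u - y) *\<^sub>R (B - A) + y *\<^sub>R (B + \<tau> *\<^sub>R (C - B) - A)"
    by (simp add: algebra_simps flip: y(3))
  then show "A + u *\<^sub>R (B - A) + v *\<^sub>R (C - B) \<in> htriangle A B (B + \<tau> *\<^sub>R (C - B))"
    unfolding convex_hull_3_alt using y uv
    by (intro CollectI exI[of _ "u - y"] exI[of _ y]) auto
qed

text \<open>Substituting \<open>v = u * t\<close> sweeps the triangle by segments from
  \<open>A\<close> to the points \<open>B + t *\<^sub>R (C - B)\<close>, at the cost of a factor
  \<open>u\<close>. Tonelli's theorem then makes the radial integral the inner one.\<close>

lemma harea_cevian_triangle_polar:
  assumes D: "cross2 (B - A) (C - B) \<noteq> 0" and \<tau>: "0 \<le> \<tau>"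
    and sub: "htriangle A B (B + \<tau> *\<^sub>R (C - B)) \<subseteq> hplane"
  shows "harea (htriangle A B (B + \<tau> *\<^sub>R (C - B))) = ennreal \<bar>cross2 (B - A) (C - B)\<bar> *
    (\<integral>\<^sup>+t. (\<integral>\<^sup>+u. ennreal (u / klein_factor (A + u *\<^sub>R (B + t *\<^sub>R (C - B) - A)) ^ 3)
      * indicator {0..1} u \<partial>lborel) * indicator {0..\<tau>} t \<partial>lborel)"
proof -
  let ?S = "htriangle A B (B + \<tau> *\<^sub>R (C - B))"
  let ?g = "\<lambda>x. ennreal (1 / klein_factor x ^ 3)"
  let ?h = "\<lambda>u t. ennreal (u / klein_factor (A + u *\<^sub>R (B + t *\<^sub>R (C - B) - A)) ^ 3)
      * indicator {0..1} u * indicator {0..\<tau>} t"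
  have S [measurable]: "?S \<in> sets borel"
    by (intro borel_compact compact_convex_hull) auto
  have [measurable]: "klein_factor \<in> borel_measurable borel"
    unfolding klein_factor_def by measurable
  have [measurable]: "(\<lambda>v. A + u *\<^sub>R (B - A) + v *\<^sub>R (C - B)) \<in> borel_measurable borel" for u
    by measurable
  have inner: "(\<integral>\<^sup>+v. ?g (A + u *\<^sub>R (B - A) + v *\<^sub>R (C - B)) * indicator ?S (A + u *\<^sub>R (B - A) + v *\<^sub>R (C - B)) \<partial>lborel)
      = (\<integral>\<^sup>+t. ?h u t \<partial>lborel)" for u
  proof (cases "0 < u")
    case True
    have "(\<integral>\<^sup>+v. ?g (A + u *\<^sub>R (B - A) + v *\<^sub>R (C - B)) * indicator ?S (A + u *\<^sub>R (B - A) + v *\<^sub>R (C - B)) \<partial>lborel)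
      = ennreal u * (\<integral>\<^sup>+t. ?g (A + u *\<^sub>R (B - A) + (0 + u * t) *\<^sub>R (C - B))
          * indicator ?S (A + u *\<^sub>R (B - A) + (0 + u * t) *\<^sub>R (C - B)) \<partial>lborel)"
      using True by (subst nn_integral_real_affine[where c = u and t = 0]) (auto simp: abs_of_pos)
    also have "\<dots> = (\<integral>\<^sup>+t. ennreal u * (?g (A + u *\<^sub>R (B - A) + (0 + u * t) *\<^sub>R (C - B))
          * indicator ?S (A + u *\<^sub>R (B - A) + (0 + u * t) *\<^sub>R (C - B))) \<partial>lborel)"
      by (rule nn_integral_cmult[symmetric]) measurable
    also have "\<dots> = (\<integral>\<^sup>+t. ?h u t \<partial>lborel)"
    proof (rule nn_integral_cong)
      fix t
      have i: "indicator ?S (A + u *\<^sub>R (B - A) + (0 + u * t) *\<^sub>R (C - B))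
          = (indicator {0..1} u * indicator {0..\<tau>} t :: ennreal)"
        using mem_htriangle_cevian_iff[OF D \<tau>, of u "u * t"] True
        by (auto simp: indicator_def zero_le_mult_iff)
      have p: "A + u *\<^sub>R (B - A) + (0 + u * t) *\<^sub>R (C - B) = A + u *\<^sub>R (B + t *\<^sub>R (C - B) - A)"
        by (simp add: algebra_simps)
      have "ennreal u * ?g x = ennreal (u / klein_factor x ^ 3)" for x
        using True by (subst ennreal_mult'[symmetric]) auto
      then show "ennreal u * (?g (A + u *\<^sub>R (B - A) + (0 + u * t) *\<^sub>R (C - B))
          * indicator ?S (A + u *\<^sub>R (B - A) + (0 + u * t) *\<^sub>R (C - B))) = ?h u t"
        unfolding i unfolding p by (simp add: mult.assoc[symmetric])
    qed
    finally show ?thesis .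
  next
    case False
    \<comment> \<open>For \<open>u = 0\<close> the slice is the single value \<open>v = 0\<close>, a
      null set; for \<open>u < 0\<close> it is empty.\<close>
    have "(\<integral>\<^sup>+v. ?g (A + u *\<^sub>R (B - A) + v *\<^sub>R (C - B)) * indicator ?S (A + u *\<^sub>R (B - A) + v *\<^sub>R (C - B)) \<partial>lborel)
        = (\<integral>\<^sup>+v. 0 \<partial>(lborel :: real measure))"
    proof (rule nn_integral_cong_AE)
      show "AE v in lborel. ?g (A + u *\<^sub>R (B - A) + v *\<^sub>R (C - B)) * indicator ?S (A + u *\<^sub>R (B - A) + v *\<^sub>R (C - B)) = 0"
        using AE_lborel_singleton[of "0::real"]
        by eventually_elim
          (use False mem_htriangle_cevian_iff[OF D \<tau>, of u] in \<open>auto simp: indicator_def\<close>)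
    qed
    moreover have "(\<integral>\<^sup>+t. ?h u t \<partial>lborel) = (\<integral>\<^sup>+t. 0 \<partial>(lborel :: real measure))"
      using False by (intro nn_integral_cong) (auto simp: indicator_def)
    ultimately show ?thesis by (simp only:)
  qed
  have cont: "continuous_on UNIV (\<lambda>(u, t). A + u *\<^sub>R (B + t *\<^sub>R (C - B) - A))"
    unfolding case_prod_unfold by (intro continuous_intros)
  have [measurable]: "(\<lambda>(u, t). A + u *\<^sub>R (B + t *\<^sub>R (C - B) - A)) \<in> borel_measurable (lborel \<Otimes>\<^sub>M lborel)"
    using borel_measurable_continuous_onI[OF cont] unfolding lborel_prod by simp
  have [measurable]: "case_prod ?h \<in> borel_measurable (lborel \<Otimes>\<^sub>M lborel)"
    by measurable
  have "harea ?S = ennreal \<bar>cross2 (B - A) (C - B)\<bar> * (\<integral>\<^sup>+u. \<integral>\<^sup>+v. ?g (A + u *\<^sub>R (B - A) + v *\<^sub>R (C - B))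
      * indicator ?S (A + u *\<^sub>R (B - A) + v *\<^sub>R (C - B)) \<partial>lborel \<partial>lborel)"
    unfolding harea_eq_nn_integral[OF S sub]
    by (rule nn_integral_lborel_affine_real2[OF D]) measurable
  also have "(\<integral>\<^sup>+u. \<integral>\<^sup>+v. ?g (A + u *\<^sub>R (B - A) + v *\<^sub>R (C - B))
      * indicator ?S (A + u *\<^sub>R (B - A) + v *\<^sub>R (C - B)) \<partial>lborel \<partial>lborel) = (\<integral>\<^sup>+u. \<integral>\<^sup>+t. ?h u t \<partial>lborel \<partial>lborel)"
    by (simp only: inner)
  also have "\<dots> = (\<integral>\<^sup>+t. \<integral>\<^sup>+u. ?h u t \<partial>lborel \<partial>lborel)"
    by (rule lborel_pair.Fubini'[symmetric]) measurable
  also have "\<dots> = (\<integral>\<^sup>+t. (\<integral>\<^sup>+u. ennreal (u / klein_factor (A + u *\<^sub>R (B + t *\<^sub>R (C - B) - A)) ^ 3)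
      * indicator {0..1} u \<partial>lborel) * indicator {0..\<tau>} t \<partial>lborel)"
    by (intro nn_integral_cong nn_integral_multc) measurable
  finally show ?thesis .
qed


text \<open>The reversed Cauchy-Schwarz inequality for \<open>(1, A)\<close> and
  \<open>(1, X)\<close>: the difference is a square plus a positive multiple of the squared
  Euclidean distance of \<open>A\<close> and \<open>X\<close>.\<close>

lemma lorentz_cauchy_schwarz_strict:
  assumes "A \<in> hplane" "X \<noteq> A"
  shows "(1 - A \<bullet> X)\<^sup>2 - (1 - A \<bullet> A) * (1 - X \<bullet> X) > 0"
proof -
  have "(1 - A \<bullet> X)\<^sup>2 - (1 - A \<bullet> A) * (1 - X \<bullet> X)
      = (A \<bullet> (X - A))\<^sup>2 + (1 - A \<bullet> A) * ((X - A) \<bullet> (X - A))"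
    by (simp add: inner_diff inner_commute power2_eq_square algebra_simps)
  moreover have "(1 - A \<bullet> A) * ((X - A) \<bullet> (X - A)) > 0"
    using assms by (simp add: hplane_iff)
  ultimately show ?thesis by (simp add: add_nonneg_pos)
qed

text \<open>The discriminant in the radial integral is \<open>(m - a * x) * (m + a * x)\<close>, and
  its first factor cancels against the boundary terms.\<close>

lemma nn_integral_klein_segment:
  assumes A: "A \<in> hplane" and X: "X \<in> hplane" and ne: "X \<noteq> A"
  shows "(\<integral>\<^sup>+u. ennreal (u / klein_factor (A + u *\<^sub>R (X - A)) ^ 3) * indicator {0..1} u \<partial>lborel)
    = ennreal (1 / (klein_factor X * (1 - A \<bullet> X + klein_factor A * klein_factor X)))"
proof -
  define \<alpha> \<beta> \<gamma> where "\<alpha> = 1 - A \<bullet> A" and "\<beta> = - (A \<bullet> (X - A))" and "\<gamma> = - ((X - A) \<bullet> (X - A))"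
  define a x m where "a = klein_factor A" and "x = klein_factor X" and "m = 1 - A \<bullet> X"
  have q: "1 - (A + u *\<^sub>R (X - A)) \<bullet> (A + u *\<^sub>R (X - A)) = \<alpha> + 2 * \<beta> * u + \<gamma> * u\<^sup>2" for u
    by (simp add: \<alpha>_def \<beta>_def \<gamma>_def inner_diff inner_add inner_commute power2_eq_square algebra_simps)
  have pos: "\<alpha> + 2 * \<beta> * u + \<gamma> * u\<^sup>2 > 0" if "0 \<le> u" "u \<le> 1" for u
  proof -
    have "A + u *\<^sub>R (X - A) \<in> hplane"
      using convexD[OF convex_hplane A X, of "1 - u" u] that by (simp add: algebra_simps)
    then show ?thesis by (simp add: hplane_iff flip: q)
  qed
  have disc: "\<beta>\<^sup>2 - \<alpha> * \<gamma> = m\<^sup>2 - (a * x)\<^sup>2"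
    unfolding a_def x_def m_def power_mult_distrib klein_factor_square[OF A] klein_factor_square[OF X]
    by (simp add: \<alpha>_def \<beta>_def \<gamma>_def inner_diff inner_commute power2_eq_square algebra_simps)
  have dpos: "m\<^sup>2 - (a * x)\<^sup>2 > 0"
    using lorentz_cauchy_schwarz_strict[OF A ne] klein_factor_square[OF A] klein_factor_square[OF X]
    by (simp add: a_def x_def m_def power_mult_distrib)
  have p: "a > 0" "x > 0" "m > 0"
    using klein_factor_pos A X inner_less_1 by (auto simp: a_def x_def m_def)
  have sq: "sqrt (\<alpha> + 2 * \<beta> * u + \<gamma> * u\<^sup>2) = klein_factor (A + u *\<^sub>R (X - A))" for u
    by (simp only: klein_factor_def q)
  have "(\<integral>\<^sup>+u. ennreal (u / klein_factor (A + u *\<^sub>R (X - A)) ^ 3) * indicator {0..1} u \<partial>lborel)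
    = ennreal (((\<alpha> + \<beta>) / sqrt (\<alpha> + 2 * \<beta> + \<gamma>) - sqrt \<alpha>) / (\<beta>\<^sup>2 - \<alpha> * \<gamma>))"
    using nn_integral_radial[OF pos] dpos by (simp only: sq disc)
  also have "((\<alpha> + \<beta>) / sqrt (\<alpha> + 2 * \<beta> + \<gamma>) - sqrt \<alpha>) / (\<beta>\<^sup>2 - \<alpha> * \<gamma>) = (m / x - a) / (m\<^sup>2 - (a * x)\<^sup>2)"
    using sq[of 0] sq[of 1]
    by (simp only: disc) (simp add: a_def x_def m_def \<alpha>_def \<beta>_def inner_diff)
  also have "\<dots> = 1 / (x * (m + a * x))"
  proof -
    have f: "m\<^sup>2 - (a * x)\<^sup>2 = (m - a * x) * (m + a * x)" by (simp add: algebra_simps power2_eq_square)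
    moreover have "m + a * x > 0" using p by (simp add: add_pos_pos)
    ultimately have "m - a * x > 0" using dpos by (simp add: zero_less_mult_iff)
    moreover have "m / x - a = (m - a * x) / x" using p by (simp add: field_simps)
    ultimately show ?thesis
      unfolding f by simp
  qed
  finally show ?thesis by (simp add: a_def x_def m_def)
qed

text \<open>For vectors \<open>a, b, x\<close> on the hyperboloid this is the half-area formula
  \<open>tan (\<Delta> / 2) = \<bar>det (a, b, x)\<bar> / (1 + \<langle>a, b\<rangle> + \<langle>b, x\<rangle> + \<langle>x, a\<rangle>)\<close>, cleared of Klein factors.\<close>

theorem harea_cevian_triangle:
  assumes A: "A \<in> hplane" and B: "B \<in> hplane" and C: "C \<in> hplane"
    and D: "cross2 (B - A) (C - B) \<noteq> 0" and \<tau>: "0 \<le> \<tau>" "\<tau> \<le> 1"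
  defines "X \<equiv> B + \<tau> *\<^sub>R (C - B)"
  shows "harea (htriangle A B X) = ennreal (2 * arctan (\<bar>cross2 (B - A) (C - B)\<bar> * \<tau> /
    (klein_factor X * (klein_factor A * klein_factor B + (1 - A \<bullet> B)) + (1 - B \<bullet> X) * klein_factor A
      + (1 - A \<bullet> X) * klein_factor B)))"
proof -
  define Y where "Y = (\<lambda>t. B + t *\<^sub>R (C - B))"
  define \<Delta> where "\<Delta> = \<bar>cross2 (B - A) (C - B)\<bar>"
  define kA kB where "kA = klein_factor A" and "kB = klein_factor B"
  define ab ad bd dd where "ab = 1 - A \<bullet> B" and "ad = - (A \<bullet> (C - B))"
    and "bd = - (B \<bullet> (C - B))" and "dd = - ((C - B) \<bullet> (C - B))"
  have YH: "Y t \<in> hplane" if "0 \<le> t" "t \<le> 1" for t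
    using convexD[OF convex_hplane B C, of "1 - t" t] that by (simp add: Y_def algebra_simps)
  have YA: "Y t \<noteq> A" for t
  proof
    assume "Y t = A"
    then have "1 *\<^sub>R (B - A) + t *\<^sub>R (C - B) = 0" by (simp add: Y_def algebra_simps)
    then show False using cross2_independent(1)[OF D] by fastforce
  qed
  have kB2: "kB\<^sup>2 = 1 - B \<bullet> B" and kA2: "kA\<^sup>2 = 1 - A \<bullet> A"
    using klein_factor_square A B by (auto simp: kA_def kB_def)
  have yy: "1 - Y t \<bullet> Y t = kB\<^sup>2 + 2 * t * bd + t\<^sup>2 * dd" for t
    unfolding kB2 by (simp add: bd_def dd_def Y_def inner_diff inner_add inner_commute power2_eq_square algebra_simps)
  have ay: "1 - A \<bullet> Y t = ab + t * ad" and by': "1 - B \<bullet> Y t = kB\<^sup>2 + t * bd" for t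
    unfolding kB2 by (simp_all add: ab_def ad_def bd_def Y_def inner_diff inner_add algebra_simps)
  have kY: "klein_factor (Y t) = sqrt (kB\<^sup>2 + 2 * t * bd + t\<^sup>2 * dd)" for t
    by (simp only: klein_factor_def yy)
  have sub: "htriangle A B (B + \<tau> *\<^sub>R (C - B)) \<subseteq> hplane"
    using A B YH[of \<tau>] \<tau> by (intro hull_minimal convex_hplane) (auto simp: Y_def)
  have X: "X = Y \<tau>" by (simp add: X_def Y_def)
  have "harea (htriangle A B X) = ennreal \<Delta> * (\<integral>\<^sup>+t. (\<integral>\<^sup>+u. ennreal (u / klein_factor (A + u *\<^sub>R (Y t - A)) ^ 3)
      * indicator {0..1} u \<partial>lborel) * indicator {0..\<tau>} t \<partial>lborel)"
    unfolding X_def Y_def \<Delta>_def by (rule harea_cevian_triangle_polar[OF D \<tau>(1) sub])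
  also have "\<dots> = ennreal \<Delta> * (\<integral>\<^sup>+t. ennreal (1 / (klein_factor (Y t) * (1 - A \<bullet> Y t + kA * klein_factor (Y t))))
      * indicator {0..\<tau>} t \<partial>lborel)"
  proof (intro arg_cong[where f = "\<lambda>x. ennreal \<Delta> * x"] nn_integral_cong)
    fix t
    show "(\<integral>\<^sup>+u. ennreal (u / klein_factor (A + u *\<^sub>R (Y t - A)) ^ 3) * indicator {0..1} u \<partial>lborel) * indicator {0..\<tau>} t
      = ennreal (1 / (klein_factor (Y t) * (1 - A \<bullet> Y t + kA * klein_factor (Y t)))) * indicator {0..\<tau>} t"
      using nn_integral_klein_segment[OF A YH YA, of t] \<tau> by (cases "t \<in> {0..\<tau>}") (simp_all add: kA_def)
  qed
  also have "\<dots> = (\<integral>\<^sup>+t. ennreal \<Delta> * (ennreal (1 / (klein_factor (Y t) * (1 - A \<bullet> Y t + kA * klein_factor (Y t))))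
      * indicator {0..\<tau>} t) \<partial>lborel)"
    unfolding kY ay by (rule nn_integral_cmult[symmetric]) measurable
  also have "\<dots> = (\<integral>\<^sup>+t. ennreal (\<Delta> / (klein_factor (Y t) * (1 - A \<bullet> Y t + kA * klein_factor (Y t))))
      * indicator {0..\<tau>} t \<partial>lborel)"
    by (intro nn_integral_cong) (simp add: \<Delta>_def mult.assoc[symmetric] ennreal_mult'[symmetric])
  also have "\<dots> = ennreal (2 * arctan (\<Delta> * \<tau> / (sqrt (kB\<^sup>2 + 2 * \<tau> * bd + \<tau>\<^sup>2 * dd) * (kA * kB + ab)
      + (kB\<^sup>2 + \<tau> * bd) * kA + (ab + \<tau> * ad) * kB)))"
    unfolding kY ay
  proof (rule nn_integral_angular[OF \<tau>(1)])
    show "0 < kA" "0 < kB" using klein_factor_pos A B by (auto simp: kA_def kB_def)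
    show "0 < \<Delta>" using D by (simp add: \<Delta>_def)
    show "0 < ab" using inner_less_1[OF A B] by (simp add: ab_def)
    fix t assume "0 \<le> t" "t \<le> \<tau>"
    then have Yt: "Y t \<in> hplane" using YH \<tau> by simp
    show "kB\<^sup>2 + 2 * t * bd + t\<^sup>2 * dd > 0" using Yt by (simp add: hplane_iff flip: yy)
    show "kB\<^sup>2 + t * bd > 0" using inner_less_1[OF B Yt] by (simp flip: by')
    show "ab + t * ad > 0" using inner_less_1[OF A Yt] by (simp flip: ay)
  next
    fix t
    \<comment> \<open>\<open>cross2 (B - A) (C - B) * t\<close> is the determinant of
      \<open>(1, A)\<close>, \<open>(1, B)\<close>, \<open>(1, Y t)\<close>, so its square is their
      Gram determinant for the Minkowski form.\<close>
    have "(\<Delta> * t)\<^sup>2 = (cross2 (B - A) (C - B) * t)\<^sup>2"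
      by (simp add: \<Delta>_def power_mult_distrib)
    also have "\<dots> = kA\<^sup>2 * kB\<^sup>2 * (kB\<^sup>2 + 2 * t * bd + t\<^sup>2 * dd)
      + 2 * ab * (kB\<^sup>2 + t * bd) * (ab + t * ad) - kA\<^sup>2 * (kB\<^sup>2 + t * bd)\<^sup>2 - kB\<^sup>2 * (ab + t * ad)\<^sup>2
      - (kB\<^sup>2 + 2 * t * bd + t\<^sup>2 * dd) * ab\<^sup>2"
      unfolding kA2 kB2 ab_def ad_def bd_def dd_def inner_real2 vector_minus_component by algebra
    finally show "(\<Delta> * t)\<^sup>2 = kA\<^sup>2 * kB\<^sup>2 * (kB\<^sup>2 + 2 * t * bd + t\<^sup>2 * dd)
      + 2 * ab * (kB\<^sup>2 + t * bd) * (ab + t * ad) - kA\<^sup>2 * (kB\<^sup>2 + t * bd)\<^sup>2 - kB\<^sup>2 * (ab + t * ad)\<^sup>2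
      - (kB\<^sup>2 + 2 * t * bd + t\<^sup>2 * dd) * ab\<^sup>2" .
  qed
  finally show ?thesis
    by (simp only: X kY ay by' \<Delta>_def kA_def kB_def ab_def)
qed

section \<open>The hyperboloid model\<close>

text \<open>The Minkowski form with the time coordinate first. With this sign, lifts of points have
  square 1, and the product of two lifts is the hyperbolic cosine of their distance.\<close>

definition lorentz :: "real \<times> (real ^ 2) \<Rightarrow> real \<times> (real ^ 2) \<Rightarrow> real" where
  "lorentz x y = fst x * fst y - snd x \<bullet> snd y"

definition hlift :: "real ^ 2 \<Rightarrow> real \<times> (real ^ 2)" where
  "hlift X = (1 / klein_factor X, (1 / klein_factor X) *\<^sub>R X)"

lemma lorentz_simps:
  "lorentz (x + y) z = lorentz x z + lorentz y z"
  "lorentz z (x + y) = lorentz z x + lorentz z y"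
  "lorentz (x - y) z = lorentz x z - lorentz y z"
  "lorentz z (x - y) = lorentz z x - lorentz z y"
  "lorentz (u *\<^sub>R x) z = u * lorentz x z"
  "lorentz z (u *\<^sub>R x) = u * lorentz z x"
  by (simp_all add: lorentz_def inner_add inner_diff algebra_simps)

lemma lorentz_commute: "lorentz x y = lorentz y x"
  by (simp add: lorentz_def inner_commute)

lemma lorentz_hlift_right: "lorentz x (hlift X) = (fst x - snd x \<bullet> X) / klein_factor X"
  by (simp add: lorentz_def hlift_def diff_divide_distrib)

lemma lorentz_hlift:
  "lorentz (hlift X) (hlift Y) = (1 - X \<bullet> Y) / (klein_factor X * klein_factor Y)"
  by (simp add: lorentz_def hlift_def diff_divide_distrib)

lemma lorentz_hlift_self: "X \<in> hplane \<Longrightarrow> lorentz (hlift X) (hlift X) = 1"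
  using klein_factor_square[of X] klein_factor_pos[of X] inner_less_1[of X X]
  by (simp add: lorentz_hlift flip: power2_eq_square)

lemma lorentz_hlift_pos: "X \<in> hplane \<Longrightarrow> Y \<in> hplane \<Longrightarrow> lorentz (hlift X) (hlift Y) > 0"
  using klein_factor_pos inner_less_1 by (simp add: lorentz_hlift)

lemma lorentz_hlift_gt_1:
  assumes X: "X \<in> hplane" and Y: "Y \<in> hplane" and ne: "X \<noteq> Y"
  shows "lorentz (hlift X) (hlift Y) > 1"
proof -
  have "(klein_factor X * klein_factor Y)\<^sup>2 < (1 - X \<bullet> Y)\<^sup>2"
    using lorentz_cauchy_schwarz_strict[OF X ne[symmetric]] X Y
    by (simp add: power_mult_distrib klein_factor_square)
  then have "klein_factor X * klein_factor Y < 1 - X \<bullet> Y"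
    using inner_less_1[OF X Y] by (intro power2_less_imp_less[of _ "1 - X \<bullet> Y"]) auto
  then show ?thesis
    using klein_factor_pos[OF X] klein_factor_pos[OF Y] by (simp add: lorentz_hlift)
qed

lemma lorentz_hlift_ge_1: "X \<in> hplane \<Longrightarrow> Y \<in> hplane \<Longrightarrow> lorentz (hlift X) (hlift Y) \<ge> 1"
  using lorentz_hlift_gt_1[of X Y] lorentz_hlift_self[of X] by (cases "X = Y") auto

lemma hdist_hlift: "hdist X Y = arcosh (lorentz (hlift X) (hlift Y))"
  by (simp add: hdist_def lorentz_hlift klein_factor_def power2_norm_eq_inner)

text \<open>Products of lifts are at least 1, so \<open>arcosh\<close> can be inverted and a circle
  becomes a plane section of the hyperboloid.\<close>

lemma mem_hcircle_iff:
  assumes "E \<in> hplane" "s > 0"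
  shows "X \<in> hcircle E s \<longleftrightarrow> X \<in> hplane \<and> lorentz (hlift E) (hlift X) = cosh s"
  using assms cosh_arcosh_real[OF lorentz_hlift_ge_1[of E X]] arcosh_cosh_real[of s]
  by (auto simp: hcircle_def hdist_hlift)

lemma hlift_ne_0: "X \<in> hplane \<Longrightarrow> hlift X \<noteq> 0"
  using klein_factor_pos[of X] by (auto simp: hlift_def zero_prod_def)

lemma hlift_scaleR_inj:
  assumes X: "X \<in> hplane" and Y: "Y \<in> hplane" and e: "hlift X = k *\<^sub>R hlift Y"
  shows "X = Y"
proof -
  have "1 / klein_factor X = k / klein_factor Y" and "(1 / klein_factor X) *\<^sub>R X = (k / klein_factor Y) *\<^sub>R Y"
    using e by (auto simp: hlift_def)
  then show ?thesis using klein_factor_pos[OF X]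
    by (metis divide_eq_0_iff less_irrefl one_neq_zero scaleR_left_imp_eq)
qed

text \<open>A line corresponds to the plane spanned by two lifts: comparing first coordinates shows
  that linear coefficients, rescaled by Klein factors, are affine weights with sum 1.\<close>

lemma hline_iff:
  assumes P: "P \<in> hplane" and Q: "Q \<in> hplane"
  shows "X \<in> hline P Q \<longleftrightarrow> X \<in> hplane \<and> (\<exists>x y. hlift X = x *\<^sub>R hlift P + y *\<^sub>R hlift Q)"
proof (cases "X \<in> hplane")
  case True
  note k = klein_factor_pos[OF P] klein_factor_pos[OF Q] klein_factor_pos[OF True]
  show ?thesis
  proof (intro iffI conjI True)
    assume "X \<in> hline P Q"
    then obtain u v where uv: "X = u *\<^sub>R P + v *\<^sub>R Q" "u + v = 1"
      unfolding hline_def affine_hull_2 by blast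
    have "hlift X = (u * klein_factor P / klein_factor X) *\<^sub>R hlift P + (v * klein_factor Q / klein_factor X) *\<^sub>R hlift Q"
      using k uv(2) arg_cong[OF uv(1), of "\<lambda>Y. (1 / klein_factor X) *\<^sub>R Y"]
      by (simp add: hlift_def algebra_simps add_divide_distrib[symmetric])
    then show "\<exists>x y. hlift X = x *\<^sub>R hlift P + y *\<^sub>R hlift Q" by blast
  next
    assume "X \<in> hplane \<and> (\<exists>x y. hlift X = x *\<^sub>R hlift P + y *\<^sub>R hlift Q)"
    then obtain x y where "hlift X = x *\<^sub>R hlift P + y *\<^sub>R hlift Q" by blast
    then have "1 / klein_factor X = x / klein_factor P + y / klein_factor Q"
      and e: "(1 / klein_factor X) *\<^sub>R X = (x / klein_factor P) *\<^sub>R P + (y / klein_factor Q) *\<^sub>R Q"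
      by (auto simp: hlift_def)
    from arg_cong[OF this(1), of "\<lambda>c. klein_factor X * c"]
    have "klein_factor X * x / klein_factor P + klein_factor X * y / klein_factor Q = 1"
      using k by (simp add: ring_distribs)
    moreover have "X = (klein_factor X * x / klein_factor P) *\<^sub>R P + (klein_factor X * y / klein_factor Q) *\<^sub>R Q"
      using arg_cong[OF e, of "\<lambda>Y. klein_factor X *\<^sub>R Y"] k by (simp add: scaleR_add_right)
    ultimately show "X \<in> hline P Q"
      unfolding hline_def affine_hull_2 using True by blast
  qed
qed (simp add: hline_def)

text \<open>The disc is convex, so the cone over it is closed under positive combinations. This
  places \<open>M\<close> inside the hyperbolic plane.\<close>

lemma hlift_positive_combination:
  assumes X: "X \<in> hplane" and Y: "Y \<in> hplane" and xy: "x > 0" "y > 0"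
  obtains Z k where "Z \<in> hplane" "k > 0" "x *\<^sub>R hlift X + y *\<^sub>R hlift Y = k *\<^sub>R hlift Z"
proof -
  define u v where "u = x / klein_factor X" and "v = y / klein_factor Y"
  have uv: "u > 0" "v > 0" using klein_factor_pos[OF X] klein_factor_pos[OF Y] xy by (auto simp: u_def v_def)
  define Z where "Z = (u / (u + v)) *\<^sub>R X + (v / (u + v)) *\<^sub>R Y"
  have Z: "Z \<in> hplane"
    unfolding Z_def using uv by (intro convexD[OF convex_hplane X Y]) (auto simp flip: add_divide_distrib)
  have e: "(u + v) *\<^sub>R Z = u *\<^sub>R X + v *\<^sub>R Y"
    using uv by (simp add: Z_def scaleR_add_right)
  have "x *\<^sub>R hlift X + y *\<^sub>R hlift Y = (u + v, u *\<^sub>R X + v *\<^sub>R Y)"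
    by (simp add: hlift_def u_def v_def)
  also have "\<dots> = ((u + v) * klein_factor Z) *\<^sub>R hlift Z"
    using klein_factor_pos[OF Z] by (simp add: hlift_def e)
  finally show ?thesis
    using that[OF Z] klein_factor_pos[OF Z] uv by (metis add_pos_pos mult_pos_pos)
qed

text \<open>A vector on the cone over a hyperbolic circle is time-like, because the polar of the circle's
  centre meets no isotropic vector.\<close>

lemma hlift_of_cone_vector:
  assumes E: "E \<in> hplane" and k: "k > 0" and h: "h \<noteq> 0" and cone: "(k * lorentz (hlift E) h)\<^sup>2 = lorentz h h"
  obtains X j where "X \<in> hplane" "j \<noteq> 0" "h = j *\<^sub>R hlift X" "k * lorentz (hlift E) (hlift X) = 1"
proof -
  have nonneg: "lorentz h h \<ge> 0" by (simp flip: cone)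
  have "fst h \<noteq> 0"
  proof
    assume "fst h = 0"
    moreover from this nonneg have "snd h \<bullet> snd h \<le> 0" by (simp add: lorentz_def)
    then have "snd h = 0" by (meson inner_gt_zero_iff not_le)
    ultimately show False using h by (simp add: prod_eq_iff)
  qed
  define X where "X = (1 / fst h) *\<^sub>R snd h"
  have hX: "h = fst h *\<^sub>R (1, X)" using \<open>fst h \<noteq> 0\<close> by (simp add: X_def prod_eq_iff)
  have hh: "lorentz h h = (fst h)\<^sup>2 * (1 - X \<bullet> X)"
    by (subst (1 2) hX) (simp add: lorentz_def power2_eq_square algebra_simps)
  have eh: "lorentz (hlift E) h = fst h / klein_factor E * (1 - E \<bullet> X)"
    by (subst hX) (simp add: lorentz_def hlift_def diff_divide_distrib algebra_simps)
  have "X \<bullet> X \<le> 1" using nonneg \<open>fst h \<noteq> 0\<close> by (simp add: hh zero_le_mult_iff)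
  \<comment> \<open>On the boundary of the disc the cone equation would give
    \<open>E \<bullet> X = 1\<close>, which is impossible for \<open>E\<close> inside.\<close>
  moreover have "X \<bullet> X \<noteq> 1"
  proof
    assume 1: "X \<bullet> X = 1"
    then have "E \<bullet> X = 1"
      using cone k klein_factor_pos[OF E] \<open>fst h \<noteq> 0\<close> by (simp add: hh eh)
    moreover have "2 * (E \<bullet> X) \<le> E \<bullet> E + X \<bullet> X"
      using inner_ge_zero[of "E - X"] by (simp add: inner_diff inner_commute)
    ultimately show False using 1 E by (simp add: hplane_iff)
  qed
  ultimately have X: "X \<in> hplane" by (simp add: hplane_iff)
  define j where "j = fst h * klein_factor X"
  have j: "j \<noteq> 0" "h = j *\<^sub>R hlift X"
    using klein_factor_pos[OF X] \<open>fst h \<noteq> 0\<close> by (auto simp: j_def hlift_def prod_eq_iff X_def)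
  have "(k * lorentz (hlift E) (hlift X))\<^sup>2 = 1"
    using cone j lorentz_hlift_self[OF X] by (simp add: lorentz_simps power_mult_distrib power2_eq_square)
  \<comment> \<open>The sign left open by the square is settled by the positivity of products of
    lifts.\<close>
  then have "k * lorentz (hlift E) (hlift X) = 1"
    using k lorentz_hlift_pos[OF E X] by (simp add: power2_eq_1_iff) (smt (verit) mult_pos_pos)
  with X j that show ?thesis by blast
qed

section \<open>Collinearity and linear independence of lifts\<close>

lemma exists_hline_through:
  assumes "P \<in> hplane"
  obtains l where "is_hline l" "P \<in> l"
proof -
  have "(1/2) *\<^sub>R axis 1 1 \<in> hplane" "0 \<in> hplane"
    by (simp_all add: hplane_iff inner_axis)
  moreover have "(1/2) *\<^sub>R axis 1 1 \<noteq> (0 :: real ^ 2)" by (simp add: axis_eq_0_iff)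
  ultimately obtain Q where "Q \<in> hplane" "P \<noteq> Q" by metis
  moreover have "P \<in> hline P Q" using assms by (simp add: hline_def hull_inc)
  ultimately show ?thesis using that assms unfolding is_hline_def by blast
qed

lemma cross2_ne_0:
  assumes A: "A \<in> hplane" and B: "B \<in> hplane" and C: "C \<in> hplane" and nc: "\<not> hcollinear {A, B, C}"
  shows "cross2 (B - A) (C - B) \<noteq> 0"
proof
  assume 0: "cross2 (B - A) (C - B) = 0"
  have line: "hcollinear S" if "P \<in> hplane" "Q \<in> hplane" "P \<noteq> Q" "S \<subseteq> hline P Q" for P Q S
    using that unfolding hcollinear_def is_hline_def by blast
  show False
  proof (cases "A = B")
    case True
    obtain l where "is_hline l" "A \<in> l" using exists_hline_through[OF A] .
    moreover have "{A, B, C} \<subseteq> hline A C" if "A \<noteq> C"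
      using True A C by (auto simp: hline_def hull_inc)
    ultimately show False
      using nc line[OF A C, of "{A, B, C}"] True by (cases "A = C") (auto simp: hcollinear_def)
  next
    case False
    \<comment> \<open>The affine parameter of \<open>C\<close> on the line \<open>AB\<close>, read
      off from a coordinate in which \<open>A\<close> and \<open>B\<close> differ.\<close>
    define u where "u = (if B $ 1 = A $ 1 then (C $ 2 - A $ 2) / (B $ 2 - A $ 2) else (C $ 1 - A $ 1) / (B $ 1 - A $ 1))"
    have "B $ 1 \<noteq> A $ 1 \<or> B $ 2 \<noteq> A $ 2" using False by (auto simp: vec_eq_iff forall_2)
    then have "C = (1 - u) *\<^sub>R A + u *\<^sub>R B"
      using 0 by (auto simp: vec_eq_iff forall_2 u_def field_simps)
    then have "C \<in> hline A B" unfolding hline_def affine_hull_2 using C by force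
    then show False
      using nc line[OF A B False, of "{A, B, C}"] A B by (auto simp: hline_def hull_inc)
  qed
qed

text \<open>Division by the Klein factors turns the coefficients into weights of sum 0, hence into a
  relation between \<open>B - A\<close> and \<open>C - B\<close>.\<close>

lemma hlift_independent:
  assumes A: "A \<in> hplane" and B: "B \<in> hplane" and C: "C \<in> hplane" and D: "cross2 (B - A) (C - B) \<noteq> 0"
    and 0: "x *\<^sub>R hlift A + y *\<^sub>R hlift B + z *\<^sub>R hlift C = 0"
  shows "x = 0" "y = 0" "z = 0"
proof -
  note k = klein_factor_pos[OF A] klein_factor_pos[OF B] klein_factor_pos[OF C]
  define u v w where "u = x / klein_factor A" and "v = y / klein_factor B" and "w = z / klein_factor C"
  have s: "u + v + w = 0" and e: "u *\<^sub>R A + v *\<^sub>R B + w *\<^sub>R C = 0"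
    using 0 by (auto simp: hlift_def u_def v_def w_def zero_prod_def)
  have u: "u = - v - w" using s by simp
  have "(v + w) *\<^sub>R (B - A) + w *\<^sub>R (C - B) = 0"
    using e unfolding u by (simp add: algebra_simps)
  from cross2_independent[OF D this] s have "u = 0" "v = 0" "w = 0" by auto
  then show "x = 0" "y = 0" "z = 0" using k by (auto simp: u_def v_def w_def)
qed

text \<open>A vector is determined by its products with the lifted vertices; the identity behind the
  Euler line is checked in this way.\<close>

lemma lorentz_nondegenerate:
  assumes A: "A \<in> hplane" and B: "B \<in> hplane" and C: "C \<in> hplane" and D: "cross2 (B - A) (C - B) \<noteq> 0"
    and 0: "lorentz x (hlift A) = 0" "lorentz x (hlift B) = 0" "lorentz x (hlift C) = 0"
  shows "x = 0"
proof -
  note k = klein_factor_pos[OF A] klein_factor_pos[OF B] klein_factor_pos[OF C]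
  define t v w where "t = fst x" and "v = snd x $ 1" and "w = snd x $ 2"
  have e: "t = v * A $ 1 + w * A $ 2" "t = v * B $ 1 + w * B $ 2" "t = v * C $ 1 + w * C $ 2"
    using 0 k by (simp_all add: lorentz_hlift_right inner_real2 t_def v_def w_def)
  have "v * cross2 (B - A) (C - B) = (v * B $ 1 + w * B $ 2 - (v * A $ 1 + w * A $ 2)) * (C - B) $ 2
      - (v * C $ 1 + w * C $ 2 - (v * B $ 1 + w * B $ 2)) * (B - A) $ 2"
    by (simp add: algebra_simps)
  then have v: "v = 0" using D by (simp add: e[symmetric])
  have "w * cross2 (B - A) (C - B) = (v * C $ 1 + w * C $ 2 - (v * B $ 1 + w * B $ 2)) * (B - A) $ 1
      - (v * B $ 1 + w * B $ 2 - (v * A $ 1 + w * A $ 2)) * (C - B) $ 1"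
    by (simp add: algebra_simps)
  then have w: "w = 0" using D by (simp add: e[symmetric])
  show ?thesis using v w e(1) by (simp add: t_def v_def w_def prod_eq_iff vec_eq_iff forall_2)
qed

section \<open>Area bisectors and second intersections\<close>

text \<open>Here \<beta> and \<gamma> are the weights of a point of \<open>BC\<close> on the lifts
  of \<open>B\<close> and \<open>C\<close>, \<open>n\<close> is its Klein factor, and
  \<open>eq\<close> equates the two half-area tangents. With
  \<open>u = n + \<gamma> - \<beta>\<close> and \<open>w = n + \<beta> - \<gamma>\<close> the
  hypotheses become \<open>\<gamma> q\<^sup>2 u = \<beta> r\<^sup>2 w\<close> and
  \<open>u w = 4 \<beta> \<gamma> p\<^sup>2\<close>; eliminating \<open>w\<close> or
  \<open>u\<close> leaves an equation between squares.\<close>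

lemma bisector_weights:
  fixes p q r \<beta> \<gamma> n :: real
  assumes pos: "p > 0" "q > 0" "r > 0" "\<beta> \<ge> 0" "\<gamma> \<ge> 0" "n > 0"
    and n2: "n\<^sup>2 = \<beta>\<^sup>2 + \<gamma>\<^sup>2 + 2 * \<beta> * \<gamma> * (2 * p\<^sup>2 - 1)"
    and eq: "\<gamma> * (n * (2 * q\<^sup>2) + (\<beta> * (2 * p\<^sup>2 - 1) + \<gamma>) + (\<beta> * (2 * r\<^sup>2 - 1) + \<gamma> * (2 * q\<^sup>2 - 1)))
      = \<beta> * (n * (2 * r\<^sup>2) + (\<beta> + \<gamma> * (2 * p\<^sup>2 - 1)) + (\<beta> * (2 * r\<^sup>2 - 1) + \<gamma> * (2 * q\<^sup>2 - 1)))"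
  obtains l where "l > 0" "\<beta> = l * (q / (q + p * r))" "\<gamma> = l * (r / (r + p * q))"
    "n = l * (p * q / (r + p * q) + p * r / (q + p * r))"
proof -
  define u w where "u = n + \<gamma> - \<beta>" and "w = n + \<beta> - \<gamma>"
  have key: "\<gamma> * q\<^sup>2 * u = \<beta> * r\<^sup>2 * w"
    using eq by (simp add: u_def w_def algebra_simps power2_eq_square)
  have uw: "u * w = 4 * \<beta> * \<gamma> * p\<^sup>2"
    using n2 by (simp add: u_def w_def algebra_simps power2_eq_square)
  have "\<beta> \<noteq> 0 \<or> \<gamma> \<noteq> 0" using n2 pos by auto
  moreover have "\<gamma> = 0" if "\<beta> = 0" using key that pos by (auto simp: u_def)
  moreover have "\<beta> = 0" if "\<gamma> = 0" using key that pos by (auto simp: w_def)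
  ultimately have bg: "\<beta> > 0" "\<gamma> > 0" using pos by (auto simp: less_le)
  then have "u * w > 0" using pos by (simp add: uw)
  \<comment> \<open>\<open>u\<close> and \<open>w\<close> have the same sign, and their sum
    \<open>2 * n\<close> is positive.\<close>
  then have u: "u > 0" and w: "w > 0"
    using pos by (auto simp: zero_less_mult_iff u_def w_def)
  have "\<gamma> * (q * u)\<^sup>2 = (\<gamma> * q\<^sup>2 * u) * u" by (simp add: power2_eq_square)
  also have "\<dots> = \<beta> * r\<^sup>2 * (u * w)" unfolding key by simp
  also have "\<dots> = \<gamma> * (2 * \<beta> * r * p)\<^sup>2" unfolding uw by (simp add: power2_eq_square)
  finally have "(q * u)\<^sup>2 = (2 * \<beta> * r * p)\<^sup>2" using bg by simp
  then have qu: "q * u = 2 * \<beta> * r * p"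
    by (rule power2_eq_imp_eq) (use pos bg u in auto)
  have "\<beta> * (r * w)\<^sup>2 = (\<beta> * r\<^sup>2 * w) * w" by (simp add: power2_eq_square)
  also have "\<dots> = \<gamma> * q\<^sup>2 * (u * w)" unfolding key[symmetric] by simp
  also have "\<dots> = \<beta> * (2 * \<gamma> * q * p)\<^sup>2" unfolding uw by (simp add: power2_eq_square)
  finally have "(r * w)\<^sup>2 = (2 * \<gamma> * q * p)\<^sup>2" using bg by simp
  then have rw: "r * w = 2 * \<gamma> * q * p"
    by (rule power2_eq_imp_eq) (use pos bg w in auto)
  have QR: "q + p * r > 0" "r + p * q > 0" using pos by (simp_all add: add_pos_pos)
  have "r * (q * u) - q * (r * w) = 2 * q * r * (\<gamma> - \<beta>)" by (simp add: u_def w_def algebra_simps)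
  then have gb: "\<gamma> * q * (r + p * q) = \<beta> * r * (q + p * r)"
    unfolding qu rw by (simp add: algebra_simps)
  define l where "l = \<beta> * (q + p * r) / q"
  have l: "l > 0" using pos bg QR by (simp add: l_def)
  have b: "\<beta> = l * (q / (q + p * r))" using pos QR by (simp add: l_def)
  have "\<gamma> = \<beta> * r * (q + p * r) / (q * (r + p * q))"
    using gb pos QR by (simp add: eq_divide_eq mult.assoc)
  also have "\<dots> = l * (r / (r + p * q))" by (simp add: l_def)
  finally have g: "\<gamma> = l * (r / (r + p * q))" .
  have "n = (q * u / q + r * w / r) / 2" using pos by (simp add: u_def w_def)
  also have "\<dots> = \<beta> * r * p / q + \<gamma> * q * p / r" unfolding qu rw by (simp add: field_simps)
  also have "\<dots> = l * (p * q / (r + p * q) + p * r / (q + p * r))"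
    unfolding b g using pos QR by (simp add: divide_simps) (simp add: algebra_simps)
  finally show ?thesis using that l b g by blast
qed

text \<open>By the half-area formula equal areas mean equal tangents, which is the equation solved
  in \<open>bisector_weights\<close>.\<close>

lemma hlift_bisector:
  assumes A: "A \<in> hplane" and B: "B \<in> hplane" and C: "C \<in> hplane"
    and D: "cross2 (B - A) (C - B) \<noteq> 0"
    and M: "M \<in> hsegment B C" and area: "harea (htriangle A B M) = harea (htriangle A M C)"
    and pos: "p > 0" "q > 0" "r > 0"
    and bc: "lorentz (hlift B) (hlift C) = 2 * p\<^sup>2 - 1"
    and ca: "lorentz (hlift C) (hlift A) = 2 * q\<^sup>2 - 1"
    and ab: "lorentz (hlift A) (hlift B) = 2 * r\<^sup>2 - 1"
  shows "(p * q / (r + p * q) + p * r / (q + p * r)) *\<^sub>R hlift M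
    = (q / (q + p * r)) *\<^sub>R hlift B + (r / (r + p * q)) *\<^sub>R hlift C"
proof -
  obtain t where t: "0 \<le> t" "t \<le> 1" and M_eq: "M = (1 - t) *\<^sub>R B + t *\<^sub>R C"
    using M by (auto simp: in_segment)
  have M1: "B + t *\<^sub>R (C - B) = M" and M2: "C + (1 - t) *\<^sub>R (B - C) = M"
    by (simp_all add: M_eq algebra_simps)
  have MH: "M \<in> hplane" using convexD[OF convex_hplane B C, of "1 - t" t] t by (simp add: M_eq)
  define kA kB kC n where "kA = klein_factor A" and "kB = klein_factor B" and "kC = klein_factor C"
    and "n = klein_factor M"
  have k: "kA > 0" "kB > 0" "kC > 0" "n > 0"
    using klein_factor_pos A B C MH by (auto simp: kA_def kB_def kC_def n_def)
  \<comment> \<open>Affine weights times Klein factors are weights on the lifts.\<close>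
  define \<beta> \<gamma> where "\<beta> = (1 - t) * kB" and "\<gamma> = t * kC"
  have bg: "\<beta> \<ge> 0" "\<gamma> \<ge> 0" using t k by (auto simp: \<beta>_def \<gamma>_def)
  have nM: "n *\<^sub>R hlift M = \<beta> *\<^sub>R hlift B + \<gamma> *\<^sub>R hlift C"
    using k by (simp add: hlift_def M_eq \<beta>_def \<gamma>_def flip: kB_def kC_def n_def)
      (simp add: n_def M_eq)
  have lM: "n * lorentz (hlift X) (hlift M) = \<beta> * lorentz (hlift X) (hlift B) + \<gamma> * lorentz (hlift X) (hlift C)" for X
    by (simp only: nM lorentz_simps flip: lorentz_simps(6))
  have self: "lorentz (hlift B) (hlift B) = 1" "lorentz (hlift C) (hlift C) = 1" "lorentz (hlift M) (hlift M) = 1"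
    using lorentz_hlift_self B C MH by auto
  have sym: "lorentz (hlift C) (hlift B) = 2 * p\<^sup>2 - 1" "lorentz (hlift A) (hlift C) = 2 * q\<^sup>2 - 1"
    using bc ca by (simp_all add: lorentz_commute)
  have lAM: "n * lorentz (hlift A) (hlift M) = \<beta> * (2 * r\<^sup>2 - 1) + \<gamma> * (2 * q\<^sup>2 - 1)"
    and lBM: "n * lorentz (hlift B) (hlift M) = \<beta> + \<gamma> * (2 * p\<^sup>2 - 1)"
    and lCM: "n * lorentz (hlift C) (hlift M) = \<beta> * (2 * p\<^sup>2 - 1) + \<gamma>"
    using lM[of A] lM[of B] lM[of C] by (simp_all add: self sym bc ab)
  have inner: "1 - X \<bullet> Y = klein_factor X * klein_factor Y * lorentz (hlift X) (hlift Y)"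
    if "X \<in> hplane" "Y \<in> hplane" for X Y
    using klein_factor_pos that by (simp add: lorentz_hlift less_imp_neq[symmetric])
  have n2: "n\<^sup>2 = \<beta>\<^sup>2 + \<gamma>\<^sup>2 + 2 * \<beta> * \<gamma> * (2 * p\<^sup>2 - 1)"
  proof -
    have "n\<^sup>2 = lorentz (n *\<^sub>R hlift M) (n *\<^sub>R hlift M)"
      by (simp only: lorentz_simps self) (simp add: power2_eq_square)
    then show ?thesis
      unfolding nM lorentz_simps self bc sym by (simp add: power2_eq_square algebra_simps)
  qed
  \<comment> \<open>\<open>N1\<close> and \<open>N2\<close> are the denominators of the half-area
    formula for \<open>A B M\<close> and \<open>A C M\<close>, multiplied by
    \<open>n\<close>.\<close>
  define N1 where "N1 = n * (2 * r\<^sup>2) + (\<beta> + \<gamma> * (2 * p\<^sup>2 - 1)) + (\<beta> * (2 * r\<^sup>2 - 1) + \<gamma> * (2 * q\<^sup>2 - 1))"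
  define N2 where "N2 = n * (2 * q\<^sup>2) + (\<beta> * (2 * p\<^sup>2 - 1) + \<gamma>) + (\<beta> * (2 * r\<^sup>2 - 1) + \<gamma> * (2 * q\<^sup>2 - 1))"
  have N1: "n * (kA * kB + (1 - A \<bullet> B)) + (1 - B \<bullet> M) * kA + (1 - A \<bullet> M) * kB = kA * kB * N1"
    unfolding N1_def lAM[symmetric] lBM[symmetric] inner[OF A B] inner[OF B MH] inner[OF A MH] ab
    by (simp add: kA_def kB_def n_def algebra_simps)
  have N2: "n * (kA * kC + (1 - A \<bullet> C)) + (1 - C \<bullet> M) * kA + (1 - A \<bullet> M) * kC = kA * kC * N2"
    unfolding N2_def lAM[symmetric] lCM[symmetric] inner[OF A C] inner[OF C MH] inner[OF A MH] sym
    by (simp add: kA_def kC_def n_def algebra_simps)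
  have "kA * kB * N1 > 0"
    unfolding N1[symmetric] using k inner_less_1[OF A B] inner_less_1[OF B MH] inner_less_1[OF A MH]
    by (simp add: add_pos_pos)
  then have N1p: "N1 > 0" by (rule zero_less_mult_pos) (use k in simp)
  have "kA * kC * N2 > 0"
    unfolding N2[symmetric] using k inner_less_1[OF A C] inner_less_1[OF C MH] inner_less_1[OF A MH]
    by (simp add: add_pos_pos)
  then have N2p: "N2 > 0" by (rule zero_less_mult_pos) (use k in simp)
  define \<Delta> where "\<Delta> = \<bar>cross2 (B - A) (C - B)\<bar>"
  have \<Delta>: "\<Delta> > 0" using D by (simp add: \<Delta>_def)
  \<comment> \<open>The other triangle is swept from \<open>C\<close> with parameter
    \<open>1 - t\<close>; exchanging \<open>B\<close> and \<open>C\<close> only changes the sign of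
    \<open>cross2\<close>.\<close>
  have cr: "cross2 (C - A) (B - C) = - cross2 (B - A) (C - B)" by (simp add: algebra_simps)
  have "harea (htriangle A B M) = ennreal (2 * arctan (\<Delta> * t / (kA * kB * N1)))"
    using harea_cevian_triangle[OF A B C D t] unfolding M1
    by (simp only: N1 \<Delta>_def flip: kA_def kB_def n_def)
  moreover have "harea (htriangle A C M) = ennreal (2 * arctan (\<Delta> * (1 - t) / (kA * kC * N2)))"
    using harea_cevian_triangle[OF A C B, of "1 - t"] D t unfolding M2 cr
    by (simp only: N2 \<Delta>_def abs_minus_cancel neg_equal_0_iff_equal not_False_eq_True flip: kA_def kC_def n_def)
  moreover have "htriangle A M C = htriangle A C M" by (simp add: insert_commute)
  ultimately have "ennreal (2 * arctan (\<Delta> * t / (kA * kB * N1))) = ennreal (2 * arctan (\<Delta> * (1 - t) / (kA * kC * N2)))"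
    using area by simp
  then have "\<Delta> * t / (kA * kB * N1) = \<Delta> * (1 - t) / (kA * kC * N2)"
    using t k N1p N2p \<Delta> by (subst (asm) ennreal_inj) (auto simp: arctan_eq_iff)
  then have "\<gamma> * N2 = \<beta> * N1"
    using k N1p N2p \<Delta> by (simp add: \<beta>_def \<gamma>_def divide_simps mult.commute mult.left_commute)
  then obtain l where l: "l > 0" "\<beta> = l * (q / (q + p * r))" "\<gamma> = l * (r / (r + p * q))"
    "n = l * (p * q / (r + p * q) + p * r / (q + p * r))"
    using bisector_weights[OF pos bg k(4) n2] unfolding N1_def N2_def by metis
  have "l *\<^sub>R ((p * q / (r + p * q) + p * r / (q + p * r)) *\<^sub>R hlift M)
    = l *\<^sub>R ((q / (q + p * r)) *\<^sub>R hlift B + (r / (r + p * q)) *\<^sub>R hlift C)"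
    using nM unfolding l(2-4) by (simp add: scaleR_add_right)
  then show ?thesis by (rule scaleR_left_imp_eq[rotated]) (use l(1) in simp)
qed

text \<open>Points of \<open>BC\<close> on \<Omega> are zeros of a binary quadratic form in the
  weights; \<open>M\<close> is one zero and Vieta's formula yields the other. The form is even in
  \<open>p\<close>, and the weights of \<open>H\<close> arise from those of \<open>M\<close>,
  cleared of denominators, by replacing \<open>p\<close> with \<open>-p\<close>.\<close>

lemma second_intersection_hlift:
  assumes B: "B \<in> hplane" and C: "C \<in> hplane" and M: "M \<in> hplane" and E: "E \<in> hplane" and k: "k > 0"
    and \<Omega>: "\<Omega> = {X \<in> hplane. k * lorentz (hlift E) (hlift X) = 1}"
    and p: "p > 1" and q: "q > 1" and r: "r > 1" and bc: "lorentz (hlift B) (hlift C) = 2 * p\<^sup>2 - 1"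
    and ind: "\<And>x y. x *\<^sub>R hlift B + y *\<^sub>R hlift C = 0 \<Longrightarrow> x = 0 \<and> y = 0"
    and eb: "k * lorentz (hlift E) (hlift B) = p * r / q" and ec: "k * lorentz (hlift E) (hlift C) = p * q / r"
    and Mw: "\<mu> *\<^sub>R hlift M = (q / (q + p * r)) *\<^sub>R hlift B + (r / (r + p * q)) *\<^sub>R hlift C"
    and M\<Omega>: "M \<in> \<Omega>"
    and sec: "second_intersection (hline B C) \<Omega> M H"
  shows "H \<in> hplane \<and> (\<exists>j. j \<noteq> 0 \<and> hlift H = j *\<^sub>R ((q * (r - p * q)) *\<^sub>R hlift B + (r * (q - p * r)) *\<^sub>R hlift C))"
proof -
  note self = lorentz_hlift_self[OF B] lorentz_hlift_self[OF C]
  have cb: "lorentz (hlift C) (hlift B) = 2 * p\<^sup>2 - 1" using bc by (simp add: lorentz_commute)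
  have pos: "p > 0" "q > 0" "r > 0" using p q r by auto
  have QR: "q + p * r > 0" "r + p * q > 0" using pos by (simp_all add: add_pos_pos)
  have wne: "q * (r - p * q) \<noteq> 0 \<or> r * (q - p * r) \<noteq> 0"
  proof (rule ccontr)
    assume "\<not> ?thesis"
    then have "r = p * q" "q = p * r" using pos by auto
    then have "q * (p * p - 1) = 0" by (simp add: algebra_simps)
    then show False using less_1_mult[OF p p] pos by simp
  qed
  \<comment> \<open>On \<Omega> the multiplier \<open>j\<close> is a linear form in the weights,
    while \<open>j\<^sup>2\<close> is the Lorentz square of the combination.\<close>
  have cone: "(x * (p * r / q) + y * (p * q / r))\<^sup>2 = x\<^sup>2 + y\<^sup>2 + 2 * x * y * (2 * p\<^sup>2 - 1)"
    if "X \<in> hplane" "X \<in> \<Omega>" "j *\<^sub>R hlift X = x *\<^sub>R hlift B + y *\<^sub>R hlift C" for X j x y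
  proof -
    have "j = k * lorentz (hlift E) (j *\<^sub>R hlift X)"
      using that(2) by (simp add: \<Omega> lorentz_simps mult.left_commute[of k])
    also have "\<dots> = x * (p * r / q) + y * (p * q / r)"
      unfolding that(3) by (simp add: lorentz_simps distrib_left mult.left_commute[of k] eb ec)
    finally have j: "j = x * (p * r / q) + y * (p * q / r)" .
    have "j\<^sup>2 = lorentz (j *\<^sub>R hlift X) (j *\<^sub>R hlift X)"
      using lorentz_hlift_self[OF that(1)] by (simp add: lorentz_simps power2_eq_square)
    also have "\<dots> = x\<^sup>2 + y\<^sup>2 + 2 * x * y * (2 * p\<^sup>2 - 1)"
      unfolding that(3) by (simp add: lorentz_simps self bc cb power2_eq_square algebra_simps)
    finally show ?thesis unfolding j .
  qed
  show ?thesis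
  proof (cases "htangent_at (hline B C) \<Omega> M")
    case True
    \<comment> \<open>With tangency there is no second point to start from. Instead the expected
      vector is shown to lie on the cone over \<Omega>; its point is then the only common point
      \<open>M\<close>.\<close>
    define h where "h = (q * (r - p * q)) *\<^sub>R hlift B + (r * (q - p * r)) *\<^sub>R hlift C"
    have h0: "h \<noteq> 0" using ind wne unfolding h_def by blast
    have eh: "k * lorentz (hlift E) h = p * (r * (r - p * q) + q * (q - p * r))"
    proof -
      have "k * lorentz (hlift E) h = (q * (r - p * q)) * (p * r / q) + (r * (q - p * r)) * (p * q / r)"
        unfolding h_def by (simp only: lorentz_simps distrib_left mult.left_commute[of k] eb ec)
      then show ?thesis using pos by (simp add: algebra_simps)
    qed
    have hh: "lorentz h h = (q * (r - p * q))\<^sup>2 + (r * (q - p * r))\<^sup>2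
        + 2 * (q * (r - p * q)) * (r * (q - p * r)) * (2 * p\<^sup>2 - 1)"
      unfolding h_def by (simp only: lorentz_simps self bc cb) algebra
    have "(k * lorentz (hlift E) h)\<^sup>2 = lorentz h h"
      unfolding eh hh by algebra
    then obtain X j where X: "X \<in> hplane" "j \<noteq> 0" "h = j *\<^sub>R hlift X" "k * lorentz (hlift E) (hlift X) = 1"
      using hlift_of_cone_vector[OF E k h0] by blast
    have hX: "hlift X = (1 / j) *\<^sub>R h" using X by simp
    have "X \<in> hline B C"
      unfolding hline_iff[OF B C] using X(1) hX by (auto simp: h_def scaleR_add_right)
    then have "X = M" using True X by (auto simp: htangent_at_def \<Omega>)
    moreover have "H = M" using sec True by (simp add: second_intersection_def)
    ultimately show ?thesis
      using X(1,2) hX unfolding h_def by (intro conjI exI[of _ "1 / j"]) auto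
  next
    case False
    then have H: "H \<in> hline B C" "H \<in> \<Omega>" "H \<noteq> M" using sec by (auto simp: second_intersection_def)
    then obtain x y where HH: "H \<in> hplane" and xy: "hlift H = x *\<^sub>R hlift B + y *\<^sub>R hlift C"
      unfolding hline_iff[OF B C] by blast
    define \<beta> \<gamma> where "\<beta> = q / (q + p * r)" and "\<gamma> = r / (r + p * q)"
    define U V W where "U = (p * r / q)\<^sup>2 - 1" and "V = (p * r / q) * (p * q / r) - (2 * p\<^sup>2 - 1)"
      and "W = (p * q / r)\<^sup>2 - 1"
    have expand: "(f\<^sup>2 - 1) * x\<^sup>2 + 2 * (f * g - d) * x * y + (g\<^sup>2 - 1) * y\<^sup>2 = 0"
      if "(x * f + y * g)\<^sup>2 = x\<^sup>2 + y\<^sup>2 + 2 * x * y * d" for f g d x y :: real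
      using that by (simp add: power2_eq_square algebra_simps)
    have 1: "U * x\<^sup>2 + 2 * V * x * y + W * y\<^sup>2 = 0"
      unfolding U_def V_def W_def by (rule expand[OF cone[OF HH H(2), of 1]]) (simp add: xy)
    have 2: "U * \<beta>\<^sup>2 + 2 * V * \<beta> * \<gamma> + W * \<gamma>\<^sup>2 = 0"
      unfolding U_def V_def W_def by (rule expand[OF cone[OF M M\<Omega>, of \<mu>]]) (simp add: Mw \<beta>_def \<gamma>_def)
    \<comment> \<open>Eliminating the mixed coefficient \<open>V\<close> leaves a product. Its first
      factor vanishes only at \<open>M\<close> itself; the second is Vieta's formula for the product
      of the roots.\<close>
    have "(\<beta> * y - \<gamma> * x) * (U * \<beta> * x - W * \<gamma> * y)
        = (U * \<beta>\<^sup>2 + 2 * V * \<beta> * \<gamma> + W * \<gamma>\<^sup>2) * x * y - (U * x\<^sup>2 + 2 * V * x * y + W * y\<^sup>2) * \<beta> * \<gamma>"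
      by (simp add: power2_eq_square algebra_simps)
    then have prod: "(\<beta> * y - \<gamma> * x) * (U * \<beta> * x - W * \<gamma> * y) = 0" by (simp add: 1 2)
    have bg: "\<beta> > 0" "\<gamma> > 0" using pos QR by (simp_all add: \<beta>_def \<gamma>_def)
    have "\<beta> * y - \<gamma> * x \<noteq> 0"
    proof
      assume 0: "\<beta> * y - \<gamma> * x = 0"
      have "\<beta> *\<^sub>R hlift H = x *\<^sub>R (\<beta> *\<^sub>R hlift B + \<gamma> *\<^sub>R hlift C)"
        using 0 by (simp add: xy scaleR_add_right mult.commute)
      also have "\<dots> = (x * \<mu>) *\<^sub>R hlift M" unfolding \<beta>_def \<gamma>_def Mw[symmetric] by simp
      finally have "(1 / \<beta>) *\<^sub>R \<beta> *\<^sub>R hlift H = (1 / \<beta>) *\<^sub>R (x * \<mu>) *\<^sub>R hlift M" by simp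
      then have "hlift H = (x * \<mu> / \<beta>) *\<^sub>R hlift M" using bg by simp
      then show False using hlift_scaleR_inj[OF HH M] H(3) by blast
    qed
    then have z: "U * \<beta> * x = W * \<gamma> * y" using prod by simp
    have UW: "U * \<beta> = - (q - p * r) / q" "W * \<gamma> = - (r - p * q) / r"
    proof -
      have "U = - ((q - p * r) * (q + p * r)) / q\<^sup>2"
        using pos by (simp add: U_def power_divide field_simps) (simp add: power2_eq_square algebra_simps)
      then show "U * \<beta> = - (q - p * r) / q" using QR pos by (simp add: \<beta>_def power2_eq_square diff_divide_distrib)
      have "W = - ((r - p * q) * (r + p * q)) / r\<^sup>2"
        using pos by (simp add: W_def power_divide field_simps) (simp add: power2_eq_square algebra_simps)
      then show "W * \<gamma> = - (r - p * q) / r" using QR pos by (simp add: \<gamma>_def power2_eq_square diff_divide_distrib)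
    qed
    have "- (q - p * r) / q * x = - (r - p * q) / r * y" using z unfolding UW .
    then have lin: "(r * (q - p * r)) * x = (q * (r - p * q)) * y"
      using pos by (simp add: field_simps)
    \<comment> \<open>The multiplier is read off from a nonzero weight, which exists by
      \<open>wne\<close>.\<close>
    obtain j where j: "x = j * (q * (r - p * q))" "y = j * (r * (q - p * r))"
    proof (cases "q * (r - p * q) = 0")
      case True
      then have "x = 0" "r * (q - p * r) \<noteq> 0" using lin wne pos by auto
      with True show ?thesis using that[of "y / (r * (q - p * r))"] by simp
    next
      case False
      then show ?thesis using that[of "x / (q * (r - p * q))"] lin by (simp add: field_simps)
    qed
    moreover have "j \<noteq> 0" using j xy hlift_ne_0[OF HH] by auto
    moreover have "hlift H = j *\<^sub>R ((q * (r - p * q)) *\<^sub>R hlift B + (r * (q - p * r)) *\<^sub>R hlift C)"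
      unfolding xy j by (simp add: scaleR_add_right)
    ultimately show ?thesis using HH by blast
  qed
qed

section \<open>The Euler line\<close>

text \<open>Comparing coefficients of the independent lifts determines a common point of the first
  two lines up to a factor, and its \<open>A\<close> and \<open>B\<close> terms form a multiple of
  \<open>hlift F\<close>. \<open>P\<close>, \<open>Q\<close>, \<open>R\<close> occur as multipliers
  instead of denominators because their counterparts for \<open>H\<close> are not known to be
  nonzero.\<close>

lemma ceva_concurrent:
  assumes A: "A \<in> hplane" and B: "B \<in> hplane" and C: "C \<in> hplane"
    and cross: "cross2 (B - A) (C - B) \<noteq> 0"
    and D: "D \<in> hplane" "hlift D = d *\<^sub>R ((q * R) *\<^sub>R hlift B + (r * Q) *\<^sub>R hlift C)"
    and E: "E \<in> hplane" "hlift E = e *\<^sub>R ((r * P) *\<^sub>R hlift C + (p * R) *\<^sub>R hlift A)"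
    and F: "F \<in> hplane" "f \<noteq> 0" "hlift F = f *\<^sub>R ((p * Q) *\<^sub>R hlift A + (q * P) *\<^sub>R hlift B)"
    and pqr: "p \<noteq> 0" "q \<noteq> 0" "r \<noteq> 0" and PQ: "P \<noteq> 0 \<or> Q \<noteq> 0"
    and X: "X \<in> hline A D" "X \<in> hline B E"
  shows "hline A D \<inter> hline B E \<inter> hline C F = {X} \<and> (\<exists>k. k \<noteq> 0 \<and>
    hlift X = k *\<^sub>R ((p * Q * R) *\<^sub>R hlift A + (q * P * R) *\<^sub>R hlift B + (r * P * Q) *\<^sub>R hlift C))"
proof -
  let ?w = "(p * Q * R) *\<^sub>R hlift A + (q * P * R) *\<^sub>R hlift B + (r * P * Q) *\<^sub>R hlift C"
  have w: "\<exists>k. k \<noteq> 0 \<and> hlift Y = k *\<^sub>R ?w" if Y: "Y \<in> hline A D" "Y \<in> hline B E" for Y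
  proof -
    obtain x y where xy: "hlift Y = x *\<^sub>R hlift A + y *\<^sub>R hlift D" and YH: "Y \<in> hplane"
      using Y(1) hline_iff[OF A D(1)] by blast
    obtain x' y' where xy': "hlift Y = x' *\<^sub>R hlift B + y' *\<^sub>R hlift E"
      using Y(2) hline_iff[OF B E(1)] by blast
    define s t where "s = y * d" and "t = y' * e"
    have s: "hlift Y = x *\<^sub>R hlift A + (s * q * R) *\<^sub>R hlift B + (s * r * Q) *\<^sub>R hlift C"
      unfolding xy D(2) by (simp add: s_def algebra_simps)
    have t: "hlift Y = (t * p * R) *\<^sub>R hlift A + x' *\<^sub>R hlift B + (t * r * P) *\<^sub>R hlift C"
      unfolding xy' E(2) by (simp add: t_def algebra_simps)
    have "(x - t * p * R) *\<^sub>R hlift A + (s * q * R - x') *\<^sub>R hlift B + (s * r * Q - t * r * P) *\<^sub>R hlift C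
        = hlift Y - hlift Y"
      by (subst (1) s, subst t) (simp add: algebra_simps)
    then have "(x - t * p * R) *\<^sub>R hlift A + (s * q * R - x') *\<^sub>R hlift B + (s * r * Q - t * r * P) *\<^sub>R hlift C = 0"
      by simp
    from hlift_independent[OF A B C cross this]
    have x: "x = t * p * R" and "s * r * Q = t * r * P" by auto
    then have st: "s * Q = t * P" using pqr by simp
    \<comment> \<open>As \<open>P\<close> and \<open>Q\<close> are not both 0, the solutions of
      \<open>s * Q = t * P\<close> are the multiples of \<open>(P, Q)\<close>.\<close>
    obtain k where k: "s = k * P" "t = k * Q"
    proof (cases "P = 0")
      case True
      then show ?thesis using that[of "t / Q"] st PQ by simp
    next
      case False
      then show ?thesis using that[of "s / P"] st by (simp add: field_simps)
    qed
    have "hlift Y = k *\<^sub>R ?w" unfolding s x k by (simp add: algebra_simps)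
    moreover have "k \<noteq> 0" using calculation hlift_ne_0[OF YH] by auto
    ultimately show ?thesis by blast
  qed
  have XH: "X \<in> hplane" using X(1) by (simp add: hline_def)
  obtain k where k: "k \<noteq> 0" "hlift X = k *\<^sub>R ?w" using w[OF X] by blast
  have "hlift X = (k * r * P * Q) *\<^sub>R hlift C + (k * R / f) *\<^sub>R hlift F"
    unfolding k(2) F(3) using F(2) by (simp add: algebra_simps)
  then have "X \<in> hline C F" using hline_iff[OF C F(1)] XH by blast
  moreover have "Y = X" if Y: "Y \<in> hline A D" "Y \<in> hline B E" for Y
  proof -
    obtain j where j: "hlift Y = j *\<^sub>R ?w" using w[OF Y] by blast
    have YH: "Y \<in> hplane" using Y by (simp add: hline_def)
    have "hlift Y = (j / k) *\<^sub>R hlift X" unfolding j k(2) using k(1) by simp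
    then show ?thesis by (rule hlift_scaleR_inj[OF YH XH])
  qed
  ultimately show ?thesis using X k by blast
qed

text \<open>With \<open>\<epsilon> = 1\<close> the left-hand side represents the point \<open>M\<close>, with \<open>\<epsilon> = -1\<close> the point \<open>H\<close>.\<close>

lemma euler_line_combination:
  fixes p q r \<epsilon> :: real
  assumes A: "A \<in> hplane" and B: "B \<in> hplane" and C: "C \<in> hplane"
    and cross: "cross2 (B - A) (C - B) \<noteq> 0"
    and pos: "p \<noteq> 0" "q \<noteq> 0" "r \<noteq> 0" and \<epsilon>: "\<epsilon>\<^sup>2 = 1"
    and bc: "lorentz (hlift B) (hlift C) = 2 * p\<^sup>2 - 1"
    and ca: "lorentz (hlift C) (hlift A) = 2 * q\<^sup>2 - 1"
    and ab: "lorentz (hlift A) (hlift B) = 2 * r\<^sup>2 - 1"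
    and o: "lorentz o' (hlift A) = 1" "lorentz o' (hlift B) = 1" "lorentz o' (hlift C) = 1"
    and e: "lorentz e (hlift A) = q * r / p" "lorentz e (hlift B) = p * r / q" "lorentz e (hlift C) = p * q / r"
  defines "P \<equiv> p + \<epsilon> * (q * r)" and "Q \<equiv> q + \<epsilon> * (p * r)" and "R \<equiv> r + \<epsilon> * (p * q)"
  shows "(p * Q * R) *\<^sub>R hlift A + (q * P * R) *\<^sub>R hlift B + (r * P * Q) *\<^sub>R hlift C
    = (2 * P * Q * R - p * Q * R - q * P * R - r * P * Q) *\<^sub>R (o' + (2 * \<epsilon>) *\<^sub>R e)"
    (is "?w = ?c *\<^sub>R _")
proof -
  note self = lorentz_hlift_self[OF A] lorentz_hlift_self[OF B] lorentz_hlift_self[OF C]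
  have sym: "lorentz (hlift C) (hlift B) = 2 * p\<^sup>2 - 1" "lorentz (hlift A) (hlift C) = 2 * q\<^sup>2 - 1"
    "lorentz (hlift B) (hlift A) = 2 * r\<^sup>2 - 1"
    using bc ca ab by (simp_all add: lorentz_commute)
  \<comment> \<open>The three products with the vertices have the same shape, so one identity serves
    all of them after renaming the variables.\<close>
  have key: "p * (p * Q * R + q * P * R * (2 * r\<^sup>2 - 1) + r * P * Q * (2 * q\<^sup>2 - 1))
      = (2 * P * Q * R - p * Q * R - q * P * R - r * P * Q) * (p + 2 * \<epsilon> * (q * r))"
    if "P = p + \<epsilon> * (q * r)" "Q = q + \<epsilon> * (p * r)" "R = r + \<epsilon> * (p * q)" for p q r P Q R :: real
    using \<epsilon> unfolding that by algebra
  have cancel: "S - c * (1 + 2 * \<epsilon> * (m / p)) = 0" if "p * S = c * (p + 2 * \<epsilon> * m)" "p \<noteq> 0" for S c m p :: real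
  proof -
    have "S = c * (p + 2 * \<epsilon> * m) / p" using that by (simp add: nonzero_eq_divide_eq mult.commute)
    then show ?thesis using that(2) by (simp add: field_simps)
  qed
  have "?w - ?c *\<^sub>R (o' + (2 * \<epsilon>) *\<^sub>R e) = 0"
  proof (rule lorentz_nondegenerate[OF A B C cross])
    show "lorentz (?w - ?c *\<^sub>R (o' + (2 * \<epsilon>) *\<^sub>R e)) (hlift A) = 0"
      unfolding lorentz_simps self sym bc ca ab o e using key[of P p q r Q R]
      by (intro cancel pos(1)) (simp add: P_def Q_def R_def)
    show "lorentz (?w - ?c *\<^sub>R (o' + (2 * \<epsilon>) *\<^sub>R e)) (hlift B) = 0"
      unfolding lorentz_simps self sym bc ca ab o e using key[of Q q p r P R]
      by (intro cancel pos(2)) (simp add: P_def Q_def R_def algebra_simps)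
    show "lorentz (?w - ?c *\<^sub>R (o' + (2 * \<epsilon>) *\<^sub>R e)) (hlift C) = 0"
      unfolding lorentz_simps self sym bc ca ab o e using key[of R r p q P Q]
      by (intro cancel pos(3)) (simp add: P_def Q_def R_def algebra_simps)
  qed
  then show ?thesis by simp
qed

theorem mainTheorem3:
  fixes A B C Ma Mb Mc Ha Hb Hc Z E :: "real ^ 2"
    and r s :: real
    and \<Omega> :: "(real ^ 2) set"
  assumes "A \<in> hplane" "B \<in> hplane" "C \<in> hplane"
    and "\<not> hcollinear {A, B, C}"
    and "Ma \<in> hsegment B C" "Mb \<in> hsegment C A" "Mc \<in> hsegment A B"
    and "harea (htriangle A B Ma) = harea (htriangle A Ma C)"
    and "harea (htriangle B C Mb) = harea (htriangle B Mb A)"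
    and "harea (htriangle C A Mc) = harea (htriangle C Mc B)"
    and "Z \<in> hplane" "r > 0" "{A, B, C} \<subseteq> hcircle Z r"
    and "E \<in> hplane" "s > 0" "\<Omega> = hcircle E s" "{Ma, Mb, Mc} \<subseteq> \<Omega>"
    and "second_intersection (hline B C) \<Omega> Ma Ha"
    and "second_intersection (hline C A) \<Omega> Mb Hb"
    and "second_intersection (hline A B) \<Omega> Mc Hc"
    and "hline A Ha \<inter> hline B Hb \<noteq> {}"
    and "hline B Hb \<inter> hline C Hc \<noteq> {}"
    and "hline C Hc \<inter> hline A Ha \<noteq> {}"
  shows "\<exists>M H. hline A Ma \<inter> hline B Mb \<inter> hline C Mc = {M} \<and>
               hline A Ha \<inter> hline B Hb \<inter> hline C Hc = {H} \<and>
               hcollinear {Z, M, E, H}"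
proof -
  note A = \<open>A \<in> hplane\<close> and B = \<open>B \<in> hplane\<close> and C = \<open>C \<in> hplane\<close>
    and Z = \<open>Z \<in> hplane\<close> and E = \<open>E \<in> hplane\<close>
  have cABC: "cross2 (B - A) (C - B) \<noteq> 0" using cross2_ne_0[OF A B C] assms(4) by blast
  then have cBCA: "cross2 (C - B) (A - C) \<noteq> 0" and cCAB: "cross2 (A - C) (B - A) \<noteq> 0"
    by (simp_all add: algebra_simps)
  have ne: "A \<noteq> B" "B \<noteq> C" "C \<noteq> A"
    using cABC cBCA by auto
  \<comment> \<open>The hyperbolic cosine of half the distance. The numbers \<open>a\<close>,
    \<open>b\<close>, \<open>c\<close> below play the part of \<open>p\<close>, \<open>q\<close>,
    \<open>r\<close> in the lemmas.\<close>
  define half where "half = (\<lambda>X Y. sqrt ((1 + lorentz (hlift X) (hlift Y)) / 2))"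
  define a b c where "a = half B C" and "b = half C A" and "c = half A B"
  have half: "half X Y > 1" "lorentz (hlift X) (hlift Y) = 2 * (half X Y)\<^sup>2 - 1"
    if "X \<in> hplane" "Y \<in> hplane" "X \<noteq> Y" for X Y
    using lorentz_hlift_gt_1[OF that] by (auto simp: half_def field_simps)
  have gt1: "a > 1" "b > 1" "c > 1"
    using half(1) A B C ne by (auto simp: a_def b_def c_def)
  have bc: "lorentz (hlift B) (hlift C) = 2 * a\<^sup>2 - 1" and ca: "lorentz (hlift C) (hlift A) = 2 * b\<^sup>2 - 1"
    and ab: "lorentz (hlift A) (hlift B) = 2 * c\<^sup>2 - 1"
    using half(2) A B C ne by (auto simp: a_def b_def c_def)
  have pos: "a > 0" "b > 0" "c > 0" using gt1 by auto
  define P Q R where "P = a + b * c" and "Q = b + a * c" and "R = c + a * b"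
  have PQR: "P > 0" "Q > 0" "R > 0" using pos by (auto simp: P_def Q_def R_def add_pos_pos)
  have hull: "Ma \<in> hplane" "Mb \<in> hplane" "Mc \<in> hplane"
    using assms(5-7) closed_segment_subset[OF _ _ convex_hplane] A B C by blast+
  define ka kb kc where "ka = a * b / R + a * c / Q" and "kb = b * c / P + a * b / R" and "kc = a * c / Q + b * c / P"
  have kpos: "ka > 0" "kb > 0" "kc > 0"
    using pos PQR by (auto simp: ka_def kb_def kc_def add_pos_pos)
  have Ma: "ka *\<^sub>R hlift Ma = (b / Q) *\<^sub>R hlift B + (c / R) *\<^sub>R hlift C"
    using hlift_bisector[OF A B C cABC assms(5,8) pos bc ca ab]
    by (simp add: ka_def Q_def R_def)
  have Mb: "kb *\<^sub>R hlift Mb = (c / R) *\<^sub>R hlift C + (a / P) *\<^sub>R hlift A"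
    using hlift_bisector[OF B C A cBCA assms(6,9) pos(2,3,1) ca ab bc]
    by (simp only: kb_def P_def R_def mult.commute[of b a])
  have Mc: "kc *\<^sub>R hlift Mc = (a / P) *\<^sub>R hlift A + (b / Q) *\<^sub>R hlift B"
    using hlift_bisector[OF C A B cCAB assms(7,10) pos(3,1,2) ab bc ca]
    by (simp only: kc_def P_def Q_def mult.commute[of c a] mult.commute[of c b])
  \<comment> \<open>This scaling makes \<Omega> the section where the product with \<open>e\<close>
    is 1.\<close>
  define k where "k = 1 / cosh s"
  have k: "k > 0" by (simp add: k_def)
  have \<Omega>: "\<Omega> = {X \<in> hplane. k * lorentz (hlift E) (hlift X) = 1}"
  proof (intro set_eqI)
    fix X
    have "k * l = 1 \<longleftrightarrow> l = cosh s" for l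
      using cosh_real_pos[of s] by (simp add: k_def divide_eq_eq)
    then show "X \<in> \<Omega> \<longleftrightarrow> X \<in> {X \<in> hplane. k * lorentz (hlift E) (hlift X) = 1}"
      unfolding \<open>\<Omega> = hcircle E s\<close> mem_hcircle_iff[OF E \<open>s > 0\<close>] by simp
  qed
  define e where "e = k *\<^sub>R hlift E"
  have eM: "lorentz e (hlift Ma) = 1" "lorentz e (hlift Mb) = 1" "lorentz e (hlift Mc) = 1"
    using assms(17) by (auto simp: \<Omega> e_def lorentz_simps)
  \<comment> \<open>The products of \<open>e\<close> with the three terms of the vector representing
    \<open>M\<close>. Each bisector foot on \<Omega> gives the sum of two of them, and the resulting
    linear system is solved.\<close>
  define x y z where "x = a / P * lorentz e (hlift A)" and "y = b / Q * lorentz e (hlift B)"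
    and "z = c / R * lorentz e (hlift C)"
  have "y + z = ka" "z + x = kb" "x + y = kc"
    using arg_cong[OF Ma, of "lorentz e"] arg_cong[OF Mb, of "lorentz e"] arg_cong[OF Mc, of "lorentz e"]
    by (simp_all only: lorentz_simps eM) (simp_all add: x_def y_def z_def)
  then have "x = b * c / P" "y = a * c / Q" "z = a * b / R"
    by (auto simp: ka_def kb_def kc_def)
  then have e: "lorentz e (hlift A) = b * c / a" "lorentz e (hlift B) = a * c / b" "lorentz e (hlift C) = a * b / c"
    using pos PQR by (auto simp: x_def y_def z_def field_simps)
  define o' where "o' = (1 / cosh r) *\<^sub>R hlift Z"
  have o': "lorentz o' (hlift A) = 1" "lorentz o' (hlift B) = 1" "lorentz o' (hlift C) = 1"
    using assms(13) mem_hcircle_iff[OF Z \<open>r > 0\<close>] cosh_real_pos[of r] by (auto simp: o'_def lorentz_simps)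
  note euler = euler_line_combination[OF A B C cABC less_imp_neq[OF pos(1), symmetric]
    less_imp_neq[OF pos(2), symmetric] less_imp_neq[OF pos(3), symmetric] _ bc ca ab o' e]

  \<comment> \<open>All weights are positive, so \<open>M\<close> exists in the plane: first the
    \<open>B\<close> and \<open>C\<close> terms are combined, then the \<open>A\<close> term is
    added.\<close>
  obtain X j where X: "X \<in> hplane" "j > 0" and jX: "(b / Q) *\<^sub>R hlift B + (c / R) *\<^sub>R hlift C = j *\<^sub>R hlift X"
    using hlift_positive_combination[OF B C] pos PQR by (metis divide_pos_pos)
  obtain M m where M: "M \<in> hplane" "m > 0" and mM: "(a / P) *\<^sub>R hlift A + j *\<^sub>R hlift X = m *\<^sub>R hlift M"
    using hlift_positive_combination[OF A X(1)] pos PQR X(2) by (metis divide_pos_pos)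
  have hM: "hlift M = (1 / m) *\<^sub>R ((a / P) *\<^sub>R hlift A + ((b / Q) *\<^sub>R hlift B + (c / R) *\<^sub>R hlift C))"
    unfolding jX mM using M by simp
  have MA: "M \<in> hline A Ma"
    using hM M(1) unfolding hline_iff[OF A hull(1)] Ma[symmetric] by (auto simp: scaleR_add_right)
  have "hlift M = (1 / m) *\<^sub>R ((b / Q) *\<^sub>R hlift B + ((c / R) *\<^sub>R hlift C + (a / P) *\<^sub>R hlift A))"
    unfolding hM by (simp add: algebra_simps)
  then have MB: "M \<in> hline B Mb"
    using M(1) unfolding hline_iff[OF B hull(2)] Mb[symmetric] by (auto simp: scaleR_add_right)
  have Ma': "hlift Ma = (1 / (ka * Q * R)) *\<^sub>R ((b * R) *\<^sub>R hlift B + (c * Q) *\<^sub>R hlift C)"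
    and Mb': "hlift Mb = (1 / (kb * P * R)) *\<^sub>R ((c * P) *\<^sub>R hlift C + (a * R) *\<^sub>R hlift A)"
    and Mc': "hlift Mc = (1 / (kc * P * Q)) *\<^sub>R ((a * Q) *\<^sub>R hlift A + (b * P) *\<^sub>R hlift B)"
    using arg_cong[OF Ma, of "\<lambda>v. (1 / ka) *\<^sub>R v"] arg_cong[OF Mb, of "\<lambda>v. (1 / kb) *\<^sub>R v"]
      arg_cong[OF Mc, of "\<lambda>v. (1 / kc) *\<^sub>R v"] kpos PQR
    by (simp_all add: scaleR_add_right)
  have nz: "a \<noteq> 0" "b \<noteq> 0" "c \<noteq> 0" "P \<noteq> 0 \<or> Q \<noteq> 0" "1 / (kc * P * Q) \<noteq> 0"
    using pos PQR kpos by auto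
  obtain m' where M_eq: "hline A Ma \<inter> hline B Mb \<inter> hline C Mc = {M}" and
    m': "hlift M = m' *\<^sub>R ((a * Q * R) *\<^sub>R hlift A + (b * P * R) *\<^sub>R hlift B + (c * P * Q) *\<^sub>R hlift C)"
    using ceva_concurrent[OF A B C cABC hull(1) Ma' hull(2) Mb' hull(3) nz(5) Mc' nz(1-4) MA MB] by blast

  \<comment> \<open>The counterparts of \<open>P\<close>, \<open>Q\<close>, \<open>R\<close> for
    \<open>\<epsilon> = -1\<close>, which turn the weights of \<open>M\<close> into those of
    \<open>H\<close>.\<close>
  define P' Q' R' where "P' = a - b * c" and "Q' = b - a * c" and "R' = c - a * b"
  have ind: "x = 0 \<and> y = 0" if "x *\<^sub>R hlift B + y *\<^sub>R hlift C = 0" for x y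
    using hlift_independent(2,3)[OF A B C cABC, of 0 x y] that by simp
  have ind': "x = 0 \<and> y = 0" if "x *\<^sub>R hlift C + y *\<^sub>R hlift A = 0" for x y
    using hlift_independent(1,3)[OF A B C cABC, of y 0 x] that by (simp add: add.commute)
  have ind'': "x = 0 \<and> y = 0" if "x *\<^sub>R hlift A + y *\<^sub>R hlift B = 0" for x y
    using hlift_independent(1,2)[OF A B C cABC, of x y 0] that by simp
  have e': "k * lorentz (hlift E) (hlift A) = b * c / a" "k * lorentz (hlift E) (hlift B) = a * c / b"
    "k * lorentz (hlift E) (hlift C) = a * b / c"
    using e by (simp_all add: e_def lorentz_simps)
  have M\<Omega>: "Ma \<in> \<Omega>" "Mb \<in> \<Omega>" "Mc \<in> \<Omega>" using assms(17) by auto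
  obtain ja where Ha: "Ha \<in> hplane" "hlift Ha = ja *\<^sub>R ((b * R') *\<^sub>R hlift B + (c * Q') *\<^sub>R hlift C)"
    using second_intersection_hlift[OF B C hull(1) E k \<Omega> gt1 bc ind e'(2,3) _ M\<Omega>(1) assms(18), of ka] Ma
    unfolding P_def Q_def R_def P'_def Q'_def R'_def by blast
  obtain jb where Hb: "Hb \<in> hplane" "hlift Hb = jb *\<^sub>R ((c * P') *\<^sub>R hlift C + (a * R') *\<^sub>R hlift A)"
    using second_intersection_hlift[OF C A hull(2) E k \<Omega> gt1(2,3,1) ca ind' _ _ _ M\<Omega>(2) assms(19), of kb] Mb e'
    unfolding P_def Q_def R_def P'_def Q'_def R'_def by (auto simp: mult.commute)
  obtain jc where Hc: "Hc \<in> hplane" "jc \<noteq> 0" "hlift Hc = jc *\<^sub>R ((a * Q') *\<^sub>R hlift A + (b * P') *\<^sub>R hlift B)"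
    using second_intersection_hlift[OF A B hull(3) E k \<Omega> gt1(3,1,2) ab ind'' _ _ _ M\<Omega>(3) assms(20), of kc] Mc e'
    unfolding P_def Q_def R_def P'_def Q'_def R'_def by (auto simp: mult.commute)
  \<comment> \<open>If both vanished, then \<open>c * c = 1\<close>, contradicting
    \<open>c > 1\<close>.\<close>
  have PQ': "P' \<noteq> 0 \<or> Q' \<noteq> 0"
  proof (rule ccontr)
    assume "\<not> ?thesis"
    then have "a = b * c" "b = a * c" by (auto simp: P'_def Q'_def)
    then have "a * (c * c - 1) = 0" by (simp add: algebra_simps)
    then show False using less_1_mult[OF gt1(3) gt1(3)] pos by simp
  qed
  obtain H where "H \<in> hline A Ha" "H \<in> hline B Hb" using assms(21) by blast
  then obtain h' where H_eq: "hline A Ha \<inter> hline B Hb \<inter> hline C Hc = {H}" and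
    h': "hlift H = h' *\<^sub>R ((a * Q' * R') *\<^sub>R hlift A + (b * P' * R') *\<^sub>R hlift B + (c * P' * Q') *\<^sub>R hlift C)"
    using ceva_concurrent[OF A B C cABC Ha Hb Hc nz(1-3) PQ'] by blast
  have H: "H \<in> hplane" using \<open>H \<in> hline A Ha\<close> by (simp add: hline_def)

  \<comment> \<open>\<open>o'\<close> and \<open>e\<close> are multiples of the lifts of the two
    centres, so a point represented by a combination of them lies on the line
    \<open>Z E\<close>.\<close>
  have span: "\<exists>u v. n *\<^sub>R l *\<^sub>R (o' + d *\<^sub>R e) = u *\<^sub>R hlift Z + v *\<^sub>R hlift E" for n l d
    by (intro exI[of _ "n * l * (1 / cosh r)"] exI[of _ "n * l * d * k"])
      (simp add: o'_def e_def scaleR_add_right mult.assoc)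
  have minus_one: "(- 1 :: real)\<^sup>2 = 1" by simp
  have "\<exists>u v. hlift M = u *\<^sub>R hlift Z + v *\<^sub>R hlift E"
    unfolding m' euler[OF power_one, unfolded mult_1_left, folded P_def Q_def R_def] by (rule span)
  moreover have "\<exists>u v. hlift H = u *\<^sub>R hlift Z + v *\<^sub>R hlift E"
    unfolding h' euler[OF minus_one, unfolded mult_minus1 add_uminus_conv_diff, folded P'_def Q'_def R'_def]
    by (rule span)
  ultimately have MH: "M \<in> hline Z E" "H \<in> hline Z E"
    using hline_iff[OF Z E] M(1) H by auto
  have "hcollinear {Z, M, E, H}"
  proof (cases "Z = E")
    case True
    \<comment> \<open>For coinciding centres \<open>hline Z E\<close> is a single point, and any
      line through it will do.\<close>
    then have "{Z, M, E, H} = {Z}" using MH by (auto simp: hline_def)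
    then show ?thesis using exists_hline_through[OF Z] unfolding hcollinear_def by auto
  next
    case False
    then have "is_hline (hline Z E)" using Z E unfolding is_hline_def by blast
    moreover have "Z \<in> hline Z E" "E \<in> hline Z E" using Z E by (auto simp: hline_def hull_inc)
    ultimately show ?thesis using MH unfolding hcollinear_def by blast
  qed
  then show ?thesis using M_eq H_eq by blast
qed

end
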